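(* Let $\Omega\subseteq[m]\times[n]$ and assume there are sets $\mathcal{I}_\alpha\times\mathcal{J}_\alpha\subseteq[m]\times[n]$ with $|\mathcal{I}_\alpha|>r$ and $|\mathcal{J}_\alpha|>r$, for $\alpha=1,\dots,s$, such that for each $1<\alpha\le s$ there are sets $\mathcal{I}'_\alpha\subseteq[m]$, $\mathcal{J}'_\alpha\subseteq[n]$ with $$(\mathcal{I}_\alpha\times\mathcal{J}_\alpha)\cap\Bigl(\bigcup_{k<\alpha}\mathcal{I}_k\times\mathcal{J}_k\Bigr)\subseteq\mathcal{I}'_\alpha\times\mathcal{J}'_\alpha\quad\text{and}\quad\min(|\mathcal{I}'_\alpha|,|\mathcal{J}'_\alpha|)\le r,$$ and such that $$\left|\Bigl(\bigcup_{\alpha=1}^s\mathcal{I}_\alpha\times\mathcal{J}_\alpha\Bigr)\setminus\Omega\right|<\sum_{\alpha=1}^s(|\mathcal{I}_\alpha|-r)(|\mathcal{J}_\alpha|-r).$$ Then $\Omega$ is a dependent set of the matroid $\mathcal{M}(r,[m]\times[n])$.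
   Context: $\Bbbk$ is an infinite field; $r,m,n$ are positive integers with $r<\min\{m,n\}$; $[m]=\{1,\dots,m\}$. $Z=(z_{ij})$ is an $m\times n$ matrix of variables and $I_{r+1}(Z)\subset\Bbbk[Z]$ is the (prime) ideal generated by all $(r+1)$-minors of $Z$. For $\Omega\subseteq[m]\times[n]$, $Z_\Omega=\{z_{ij}:(i,j)\in\Omega\}$. The determinantal matroid $\mathcal{M}(r,[m]\times[n])$ is the matroid on the ground set $[m]\times[n]$ in which $\Omega$ is independent if and only if $I_{r+1}(Z)\cap\Bbbk[Z_\Omega]=0$, and dependent otherwise. *)

theory Defs
  imports
    "HOL-Library.Poly_Mapping"
    "HOL-Algebra.Ideal"
    "Jordan_Normal_Form.Determinant"
    "Jordan_Normal_Form.DL_Submatrix"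
begin

text \<open>
  A polynomial is a finitely supported map from monomials to coefficients, a monomial being a
  finitely supported map from variables to exponents. The variables are pairs \<open>(i, j)\<close> of natural
  numbers, standing for \<open>z\<^sub>i\<^sub>j\<close>.
\<close>

type_synonym 'k zpoly = "((nat \<times> nat) \<Rightarrow>\<^sub>0 nat) \<Rightarrow>\<^sub>0 'k"

definition zvar :: "nat \<times> nat \<Rightarrow> 'k::field zpoly"
  where "zvar v = Poly_Mapping.single (Poly_Mapping.single v 1) 1"

definition polys_in :: "(nat \<times> nat) set \<Rightarrow> 'k::field zpoly set"
  where "polys_in V = {p. \<forall>t \<in> Poly_Mapping.keys p. Poly_Mapping.keys t \<subseteq> V}"

definition poly_ring_in :: "(nat \<times> nat) set \<Rightarrow> 'k::field zpoly ring"
  where "poly_ring_in V =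
    \<lparr>carrier = polys_in V, monoid.mult = (*), one = 1, ring.zero = 0, add = (+)\<rparr>"

lemma polys_in_diff: "p \<in> polys_in V \<Longrightarrow> q \<in> polys_in V \<Longrightarrow> p - q \<in> polys_in V"
  using keys_diff[of p q] by (fastforce simp: polys_in_def)

lemma polys_in_add: "p \<in> polys_in V \<Longrightarrow> q \<in> polys_in V \<Longrightarrow> p + q \<in> polys_in V"
  using Poly_Mapping.keys_add[of p q] by (fastforce simp: polys_in_def)

lemma polys_in_0: "0 \<in> polys_in V"
  by (simp add: polys_in_def)

lemma polys_in_1: "1 \<in> polys_in V"
  by (simp add: polys_in_def)

lemma polys_in_mult:
  assumes "p \<in> polys_in V" "q \<in> polys_in V"
  shows "p * q \<in> polys_in V"
proof -
  have "Poly_Mapping.keys t \<subseteq> V" if t: "t \<in> Poly_Mapping.keys (p * q)" for t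
  proof -
    obtain a b where "a \<in> Poly_Mapping.keys p" "b \<in> Poly_Mapping.keys q" "t = a + b"
      using t keys_mult[of p q] by blast
    then show ?thesis
      using assms Poly_Mapping.keys_add[of a b] by (fastforce simp: polys_in_def)
  qed
  then show ?thesis by (auto simp: polys_in_def)
qed

lemma cring_poly_ring_in: "cring (poly_ring_in V :: 'k::field zpoly ring)"
proof (rule cringI)
  show "abelian_group (poly_ring_in V :: 'k zpoly ring)"
  proof (rule abelian_groupI)
    fix p :: "'k zpoly" assume "p \<in> carrier (poly_ring_in V)"
    then have "- p \<in> polys_in V"
      using polys_in_diff[OF polys_in_0, of p] by (simp add: poly_ring_in_def)
    then show "\<exists>q\<in>carrier (poly_ring_in V). q \<oplus>\<^bsub>poly_ring_in V\<^esub> p = \<zero>\<^bsub>poly_ring_in V\<^esub>"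
      by (auto simp: poly_ring_in_def intro!: bexI[of _ "- p"])
  qed (auto simp: poly_ring_in_def polys_in_add polys_in_0 ac_simps)
  show "comm_monoid (poly_ring_in V :: 'k zpoly ring)"
    by (rule comm_monoidI) (auto simp: poly_ring_in_def polys_in_mult polys_in_1 ac_simps)
qed (auto simp: poly_ring_in_def algebra_simps)

definition grid :: "nat \<Rightarrow> nat \<Rightarrow> (nat \<times> nat) set"
  where "grid m n = {1..m} \<times> {1..n}"

text \<open>
  Library matrices are indexed from \<open>0\<close>, while the variables are indexed by \<open>{1..m} \<times> {1..n}\<close>;
  hence the shift. The sets \<open>A\<close> and \<open>B\<close> below select rows and columns by \<open>0\<close>-based position.
\<close>

definition generic_matrix :: "nat \<Rightarrow> nat \<Rightarrow> 'k::field zpoly mat"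
  where "generic_matrix m n = mat m n (\<lambda>(i, j). zvar (Suc i, Suc j))"

definition minors :: "nat \<Rightarrow> 'a::comm_ring_1 mat \<Rightarrow> 'a set"
  where "minors t M = {det (submatrix M A B) | A B.
    A \<subseteq> {0..<dim_row M} \<and> B \<subseteq> {0..<dim_col M} \<and> card A = t \<and> card B = t}"

definition determinantal_ideal :: "nat \<Rightarrow> nat \<Rightarrow> nat \<Rightarrow> 'k::field zpoly set"
  where "determinantal_ideal t m n =
    genideal (poly_ring_in (grid m n)) (minors t (generic_matrix m n))"

text \<open>
  A matroid is represented by its ground set together with its family of independent sets. The
  first argument of \<open>determinantal_matroid\<close> only fixes the coefficient field.
\<close>

type_synonym 'a set_system = "'a set \<times> 'a set set"

definition dependent_in :: "'a set_system \<Rightarrow> 'a set \<Rightarrow> bool"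
  where "dependent_in M X \<longleftrightarrow> X \<subseteq> fst M \<and> X \<notin> snd M"

definition determinantal_matroid ::
    "'k::field itself \<Rightarrow> nat \<Rightarrow> nat \<Rightarrow> nat \<Rightarrow> (nat \<times> nat) set_system"
  where "determinantal_matroid _ r m n =
    (grid m n,
     {\<Omega>. \<Omega> \<subseteq> grid m n \<and>
       (determinantal_ideal (r + 1) m n :: 'k zpoly set) \<inter> polys_in \<Omega> = {0}})"

end

theory Submission
  imports Defs
begin

text \<open>
The idea is to count parameters on the matrices of rank at most \<open>r\<close>, that is, on the products
\<open>U V\<close> with inner dimension \<open>r\<close>. In a block \<open>I \<times> J\<close> of such a matrix, fix \<open>r\<close> rows \<open>A\<close> and \<open>r\<close>
columns \<open>B\<close>. The bordered minor on \<open>A \<union> {i}\<close> and \<open>B \<union> {j}\<close> is zero, which expresses the entry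
\<open>(i, j)\<close> as a quotient of polynomials in the entries of the cross \<open>A \<times> J \<union> I \<times> B\<close>
(\<open>rational_over_cross\<close>). So the \<open>(|I| - r) (|J| - r)\<close> entries outside the cross are determined by
the cross. Run through the blocks in order. The earlier entries meet the new block inside a
rectangle \<open>I' \<times> J'\<close> with at most \<open>r\<close> rows or at most \<open>r\<close> columns, so \<open>A\<close> or \<open>B\<close> can be chosen such
that the cross contains this overlap. The determined entries are then all new, and the savings
of the different blocks add up (\<open>spanning_set_of_blocks\<close>): all entries in the union \<open>X\<close> of the
blocks are rational functions of a set \<open>Y\<close> of entries, where \<open>|Y|\<close> is at most \<open>|X|\<close> minus the sum
of all \<open>(|I| - r) (|J| - r)\<close>. The cardinality hypothesis says that this is less than
\<open>|X \<inter> \<Omega>|\<close>. Counting monomials gives a nonzero polynomial \<open>f\<close> in the variables of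
\<open>X \<inter> \<Omega>\<close> that vanishes on all matrices of rank at most \<open>r\<close> (\<open>algebraic_relation_exists\<close>).

It remains to pass from vanishing to membership in the ideal. Instead of the primality of the
determinantal ideal it is enough that some power of \<open>f\<close> lies in it, because this power is again a
nonzero polynomial in the same variables. For this, let \<open>t \<le> r\<close>. Modulo the \<open>(t + 1)\<close>-minors, and
after inverting a \<open>t\<close>-minor \<open>d\<close>, the generic matrix itself factors with inner dimension \<open>t\<close>, by the
same bordered minors. So some power of \<open>d\<close> multiplies \<open>f\<close> into the ideal of \<open>(t + 1)\<close>-minors.
Climbing from \<open>t = 0\<close>, where the ideal is the whole ring, to \<open>t = r\<close> yields a power of \<open>f\<close> in the
ideal of \<open>(r + 1)\<close>-minors (\<open>vanishes_on_rank_imp_power_in_determinantal_ideal\<close>).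

Over an infinite field a polynomial is zero if all its values are. Therefore all computations with
fractions and with generic matrices of rank at most \<open>r\<close> are made with values at points.
\<close>

section \<open>Values of polynomials at points\<close>

definition monom_value :: "('v \<Rightarrow> 'k::field) \<Rightarrow> ('v \<Rightarrow>\<^sub>0 nat) \<Rightarrow> 'k"
  where "monom_value w t = (\<Prod>v\<in>Poly_Mapping.keys t. w v ^ Poly_Mapping.lookup t v)"

definition mpoly_value :: "('v \<Rightarrow> 'k::field) \<Rightarrow> (('v \<Rightarrow>\<^sub>0 nat) \<Rightarrow>\<^sub>0 'k) \<Rightarrow> 'k"
  where "mpoly_value w p = (\<Sum>t\<in>Poly_Mapping.keys p. Poly_Mapping.lookup p t * monom_value w t)"

lemma monom_value_superset:
  assumes "finite F" "Poly_Mapping.keys t \<subseteq> F"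
  shows "monom_value w t = (\<Prod>v\<in>F. w v ^ Poly_Mapping.lookup t v)"
  unfolding monom_value_def
  by (rule prod.mono_neutral_left) (use assms in \<open>auto simp: in_keys_iff\<close>)

lemma monom_value_add: "monom_value w (s + t) = monom_value w s * monom_value w t"
proof -
  let ?F = "Poly_Mapping.keys s \<union> Poly_Mapping.keys t"
  have "monom_value w u = (\<Prod>v\<in>?F. w v ^ Poly_Mapping.lookup u v)"
    if "Poly_Mapping.keys u \<subseteq> ?F" for u
    by (rule monom_value_superset) (use that in auto)
  then show ?thesis
    using Poly_Mapping.keys_add[of s t] by (simp add: lookup_add power_add prod.distrib)
qed

lemma monom_value_0 [simp]: "monom_value w 0 = 1"
  by (simp add: monom_value_def)

lemma mpoly_value_superset:
  assumes "finite F" "Poly_Mapping.keys p \<subseteq> F"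
  shows "mpoly_value w p = (\<Sum>t\<in>F. Poly_Mapping.lookup p t * monom_value w t)"
  unfolding mpoly_value_def
  by (rule sum.mono_neutral_left) (use assms in \<open>auto simp: in_keys_iff\<close>)

lemma mpoly_value_add: "mpoly_value w (p + q) = mpoly_value w p + mpoly_value w q"
proof -
  let ?F = "Poly_Mapping.keys p \<union> Poly_Mapping.keys q"
  have "mpoly_value w r = (\<Sum>t\<in>?F. Poly_Mapping.lookup r t * monom_value w t)"
    if "Poly_Mapping.keys r \<subseteq> ?F" for r
    by (rule mpoly_value_superset) (use that in auto)
  then show ?thesis
    using Poly_Mapping.keys_add[of p q] by (simp add: lookup_add distrib_right sum.distrib)
qed

lemma mpoly_value_0 [simp]: "mpoly_value w 0 = 0"
  by (simp add: mpoly_value_def)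

lemma mpoly_value_sum: "mpoly_value w (\<Sum>i\<in>A. f i) = (\<Sum>i\<in>A. mpoly_value w (f i))"
  by (induction A rule: infinite_finite_induct) (auto simp: mpoly_value_add)

lemma mpoly_value_single [simp]: "mpoly_value w (Poly_Mapping.single t c) = c * monom_value w t"
  by (cases "c = 0") (auto simp: mpoly_value_def)

lemma poly_eq_sum_monomials:
  fixes p :: "('a \<Rightarrow>\<^sub>0 'b::comm_monoid_add)"
  shows "p = (\<Sum>t\<in>Poly_Mapping.keys p. Poly_Mapping.single t (Poly_Mapping.lookup p t))"
  by (rule poly_mapping_eqI)
    (auto simp: lookup_sum lookup_single when_def in_keys_iff)

lemma mpoly_value_mult: "mpoly_value w (p * q) = mpoly_value w p * mpoly_value w q"
proof -
  have "p * q = (\<Sum>s\<in>Poly_Mapping.keys p. \<Sum>t\<in>Poly_Mapping.keys q.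
      Poly_Mapping.single (s + t) (Poly_Mapping.lookup p s * Poly_Mapping.lookup q t))"
    by (subst poly_eq_sum_monomials[of p], subst poly_eq_sum_monomials[of q])
      (simp add: sum_product mult_single)
  then have "mpoly_value w (p * q) = (\<Sum>s\<in>Poly_Mapping.keys p. \<Sum>t\<in>Poly_Mapping.keys q.
      (Poly_Mapping.lookup p s * monom_value w s) * (Poly_Mapping.lookup q t * monom_value w t))"
    by (simp add: mpoly_value_sum monom_value_add mult_ac)
  then show ?thesis
    by (simp add: mpoly_value_def sum_product)
qed

lemma mpoly_value_1 [simp]: "mpoly_value w 1 = 1"
  using mpoly_value_single[of w 0 1] by simp

global_interpretation mpoly_value: comm_ring_hom "mpoly_value w"
  by unfold_locales (auto simp: mpoly_value_add mpoly_value_mult)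

lemma mpoly_value_zvar [simp]: "mpoly_value w (zvar v) = w v"
  by (simp add: zvar_def monom_value_def)

text \<open>
This is the independence of characters: a monomial is multiplicative in the point, and two
distinct monomials are distinct functions on an infinite field. The proof is Artin's. Replacing \<open>w\<close>
by a multiple \<open>u w\<close> and subtracting the value of the monomial \<open>b\<close> at \<open>u\<close> times the original
relation gives a relation in which \<open>b\<close> no longer occurs.
\<close>

lemma monom_values_independent:
  fixes c :: "('v \<Rightarrow>\<^sub>0 nat) \<Rightarrow> 'k::field"
  assumes inf: "infinite (UNIV :: 'k set)" and "finite A"
    and "\<And>w. (\<Sum>t\<in>A. c t * monom_value w t) = 0"
  shows "\<forall>t\<in>A. c t = 0"
  using assms(2,3)
proof (induction A arbitrary: c rule: finite_induct)
  case empty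
  then show ?case by simp
next
  case (insert b A)
  have c0: "c a = 0" if a: "a \<in> A" for a
  proof -
    have "a \<noteq> b" using a insert.hyps by auto
    then obtain v where v: "Poly_Mapping.lookup a v \<noteq> Poly_Mapping.lookup b v"
      by (meson poly_mapping_eqI)
    let ?q = "monom 1 (Poly_Mapping.lookup a v) - monom 1 (Poly_Mapping.lookup b v) :: 'k poly"
    have "?q \<noteq> 0" using v
      by (metis eq_iff_diff_eq_0 monom_eq_iff' zero_neq_one)
    then have "finite {x. poly ?q x = 0}" by (rule poly_roots_finite)
    then obtain x where x: "poly ?q x \<noteq> 0" using inf
      by (metis (mono_tags, lifting) Collect_cong UNIV_def)
    let ?u = "\<lambda>y. if y = v then x else 1"
    have mv: "monom_value ?u t = x ^ Poly_Mapping.lookup t v" for t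
    proof -
      have "monom_value ?u t = (\<Prod>y\<in>insert v (Poly_Mapping.keys t). ?u y ^ Poly_Mapping.lookup t y)"
        by (rule monom_value_superset) auto
      also have "\<dots> = x ^ Poly_Mapping.lookup t v * (\<Prod>y\<in>Poly_Mapping.keys t - {v}. ?u y ^ Poly_Mapping.lookup t y)"
        by (simp add: prod.insert_remove)
      also have "(\<Prod>y\<in>Poly_Mapping.keys t - {v}. ?u y ^ Poly_Mapping.lookup t y) = 1"
        by (rule prod.neutral) auto
      finally show ?thesis by simp
    qed
    have "(\<Sum>t\<in>A. (c t * (monom_value ?u t - monom_value ?u b)) * monom_value w t) = 0" for w
    proof -
      have mm: "monom_value (\<lambda>y. ?u y * w y) t = monom_value ?u t * monom_value w t" for t
        by (simp add: monom_value_def power_mult_distrib prod.distrib)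
      have "(\<Sum>t\<in>insert b A. c t * monom_value (\<lambda>y. ?u y * w y) t)
          - monom_value ?u b * (\<Sum>t\<in>insert b A. c t * monom_value w t) = 0"
        using insert.prems by simp
      then have "(\<Sum>t\<in>insert b A. (c t * (monom_value ?u t - monom_value ?u b)) * monom_value w t) = 0"
        unfolding mm sum_distrib_left sum_subtractf[symmetric] by (simp add: algebra_simps)
      then show ?thesis using insert.hyps by simp
    qed
    then have "\<forall>t\<in>A. c t * (monom_value ?u t - monom_value ?u b) = 0" by (rule insert.IH)
    moreover have "monom_value ?u a - monom_value ?u b \<noteq> 0"
      using x by (simp add: mv poly_monom)
    ultimately show ?thesis using a by auto
  qed
  then have "c b * monom_value (\<lambda>_. 1) b = 0"
    using insert.prems[of "\<lambda>_. 1"] insert.hyps by simp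
  then have "c b = 0" by (simp add: monom_value_def)
  then show ?case using c0 by simp
qed

lemma mpoly_value_eq_0_imp:
  fixes p :: "('v \<Rightarrow>\<^sub>0 nat) \<Rightarrow>\<^sub>0 'k::field"
  assumes "infinite (UNIV :: 'k set)" and "\<And>w. mpoly_value w p = 0"
  shows "p = 0"
proof -
  have "\<forall>t\<in>Poly_Mapping.keys p. Poly_Mapping.lookup p t = 0"
    by (rule monom_values_independent[OF assms(1)]) (use assms(2) in \<open>auto simp: mpoly_value_def\<close>)
  then show ?thesis by (metis in_keys_iff poly_mapping_eqI lookup_zero)
qed

section \<open>Polynomials in a given set of variables\<close>

lemma polys_in_single_0 [simp]: "Poly_Mapping.single 0 c \<in> polys_in V"
  by (auto simp: polys_in_def)

lemma polys_in_uminus: "p \<in> polys_in V \<Longrightarrow> - p \<in> polys_in V"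
  using polys_in_diff[OF polys_in_0] by fastforce

lemma polys_in_sum: "(\<And>i. i \<in> A \<Longrightarrow> f i \<in> polys_in V) \<Longrightarrow> (\<Sum>i\<in>A. f i) \<in> polys_in V"
  by (induction A rule: infinite_finite_induct) (auto simp: polys_in_0 polys_in_add)

lemma polys_in_prod: "(\<And>i. i \<in> A \<Longrightarrow> f i \<in> polys_in V) \<Longrightarrow> (\<Prod>i\<in>A. f i) \<in> polys_in V"
  by (induction A rule: infinite_finite_induct) (auto simp: polys_in_1 polys_in_mult)

lemma polys_in_power: "p \<in> polys_in V \<Longrightarrow> p ^ k \<in> polys_in V"
  by (induction k) (auto simp: polys_in_1 polys_in_mult)

lemma polys_in_zvar: "v \<in> V \<Longrightarrow> zvar v \<in> polys_in V"
  by (auto simp: polys_in_def zvar_def)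

lemma polys_in_mono: "V \<subseteq> W \<Longrightarrow> polys_in V \<subseteq> polys_in W"
  unfolding polys_in_def by blast

lemma polys_in_of_nat: "of_nat k \<in> polys_in V"
  by (induction k) (auto simp: polys_in_0 polys_in_1 polys_in_add)

lemma polys_in_signof: "signof \<pi> \<in> polys_in V"
  by (auto simp: sign_def polys_in_1 polys_in_uminus)

lemma polys_in_det:
  assumes "A \<in> carrier_mat t t" "\<And>i j. i < t \<Longrightarrow> j < t \<Longrightarrow> A $$ (i, j) \<in> polys_in V"
  shows "det A \<in> polys_in V"
  unfolding det_def'[OF assms(1)]
proof (intro polys_in_sum polys_in_mult polys_in_signof polys_in_prod assms(2))
  fix \<pi> i assume "\<pi> \<in> {\<pi>. \<pi> permutes {0..<t}}" "i \<in> {0..<t}"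
  then show "i < t" "\<pi> i < t"
    using permutes_in_image[of \<pi> "{0..<t}" i] by auto
qed

section \<open>Minors of the generic matrix\<close>

text \<open>
A minor of the generic matrix, with its rows and columns given by enumerations \<open>a\<close> and \<open>b\<close> and not
by sets. They may repeat or be out of order, so that a minor can be bordered by any row and column.
\<close>

definition zdet :: "nat \<Rightarrow> (nat \<Rightarrow> nat) \<Rightarrow> (nat \<Rightarrow> nat) \<Rightarrow> 'k::field zpoly"
  where "zdet t a b = det (mat t t (\<lambda>(p, q). zvar (a p, b q)))"

lemma zdet_in: "zdet t a b \<in> polys_in (a ` {..<t} \<times> b ` {..<t})"
  unfolding zdet_def by (rule polys_in_det[where t = t]) (auto intro!: polys_in_zvar)

lemma mpoly_value_zdet: "mpoly_value w (zdet t a b) = det (mat t t (\<lambda>(p, q). w (a p, b q)))"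
  unfolding zdet_def mpoly_value.hom_det[symmetric]
  by (intro arg_cong[of _ _ det] eq_matI) auto

text \<open>
Border the minor with rows \<open>a\<close> and columns \<open>b\<close> by the row \<open>i\<close> and some column. These are the cofactors
along the new column. The column itself is deleted in them, so they are the same for every choice of
it; the choice made here is the column \<open>b t\<close>.
\<close>

definition border_cofactor ::
    "nat \<Rightarrow> (nat \<Rightarrow> nat) \<Rightarrow> (nat \<Rightarrow> nat) \<Rightarrow> nat \<Rightarrow> nat \<Rightarrow> 'k::field zpoly"
  where "border_cofactor t a b i p =
    cofactor (mat (Suc t) (Suc t) (\<lambda>(x, y). zvar ((a(t := i)) x, b y))) p t"

lemma border_cofactor_in:
  assumes "p < t"
  shows "border_cofactor t a b i p \<in> polys_in (insert i (a ` {..<t}) \<times> b ` {..<t})"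
  unfolding border_cofactor_def cofactor_def
proof (rule polys_in_mult)
  show "(- 1) ^ (p + t) \<in> polys_in (insert i (a ` {..<t}) \<times> b ` {..<t})"
    by (intro polys_in_power polys_in_uminus polys_in_1)
  show "det (mat_delete (mat (Suc t) (Suc t) (\<lambda>(x, y). zvar ((a(t := i)) x, b y))) p t)
      \<in> polys_in (insert i (a ` {..<t}) \<times> b ` {..<t})"
    by (rule polys_in_det[where t = t]) (auto simp: mat_delete_def intro!: polys_in_zvar)
qed

text \<open>
Since the cofactors depend on \<open>i\<close> but not on \<open>j\<close>, the sum on the right is the entry \<open>(i, j)\<close> of a
product of matrices with inner dimension \<open>t\<close>. Wherever the bordered minors vanish, this writes
\<open>zdet t a b * zvar (i, j)\<close> as such an entry. Both halves of the main argument rest on this.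
\<close>

lemma zdet_bordered:
  "zdet (Suc t) (a(t := i)) (b(t := j)) =
    zdet t a b * zvar (i, j) + (\<Sum>p<t. border_cofactor t a b i p * zvar (a p, j))"
proof -
  let ?M = "mat (Suc t) (Suc t) (\<lambda>(x, y). zvar ((a(t := i)) x, (b(t := j)) y)) :: 'a zpoly mat"
  have *: "cofactor ?M p t = border_cofactor t a b i p" if "p \<le> t" for p
    unfolding border_cofactor_def cofactor_def
    by (intro arg_cong2[of _ _ _ _ "(*)"] arg_cong[of _ _ det] refl eq_matI)
      (auto simp: mat_delete_def)
  have **: "border_cofactor t a b i t = zdet t a b"
    unfolding border_cofactor_def cofactor_def zdet_def mult_2[symmetric] power_mult
    by simp (intro arg_cong[of _ _ det] eq_matI, auto simp: mat_delete_def)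
  have "det ?M = (\<Sum>p<Suc t. ?M $$ (p, t) * cofactor ?M p t)"
    by (rule laplace_expansion_column) auto
  also have "\<dots> = (\<Sum>p<Suc t. ?M $$ (p, t) * border_cofactor t a b i p)"
    by (intro sum.cong) (auto simp only: * lessThan_iff less_Suc_eq_le)
  also have "\<dots> = (\<Sum>p<t. border_cofactor t a b i p * zvar (a p, j)) + zdet t a b * zvar (i, j)"
    by (simp add: ** mult.commute)
  finally show ?thesis by (simp add: zdet_def)
qed

lemma det_mat_permute_rows:
  assumes "\<sigma> permutes {0..<t}"
  shows "det (mat t t (\<lambda>(i, j). F (\<sigma> i) j)) = signof \<sigma> * det (mat t t (\<lambda>(i, j). F i j))"
proof -
  have "mat t t (\<lambda>(i, j). F (\<sigma> i) j) = mat t t (\<lambda>(i, j). mat t t (\<lambda>(i, j). F i j) $$ (\<sigma> i, j))"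
    using permutes_in_image[OF assms] by (intro eq_matI) auto
  then show ?thesis
    using det_permute_rows[OF mat_carrier assms, of "\<lambda>(i, j). F i j"] by simp
qed

lemma det_mat_permute_cols:
  assumes "\<sigma> permutes {0..<t}"
  shows "det (mat t t (\<lambda>(i, j). F i (\<sigma> j))) = signof \<sigma> * det (mat t t (\<lambda>(i, j). F i j))"
proof -
  have tr: "det (mat t t (\<lambda>(i, j). G i j)) = det (mat t t (\<lambda>(i, j). G j i))" for G :: "nat \<Rightarrow> nat \<Rightarrow> 'a"
    by (subst det_transpose[OF mat_carrier, symmetric]) (auto intro!: arg_cong[of _ _ det] eq_matI)
  show ?thesis
    unfolding tr[of "\<lambda>i j. F i (\<sigma> j)"] tr[of F]
    by (rule det_mat_permute_rows[OF assms])
qed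

lemma inj_on_eq_pick_permute:
  assumes inj: "inj_on f {..<t}"
  obtains \<sigma> where "\<sigma> permutes {0..<t}" "\<And>i. i < t \<Longrightarrow> pick (f ` {..<t}) (\<sigma> i) = f i"
proof -
  let ?A = "f ` {..<t}"
  define \<sigma> where "\<sigma> i = (if i < t then card {x \<in> ?A. x < f i} else i)" for i
  have pk: "pick ?A (\<sigma> i) = f i" if "i < t" for i
    using that pick_card_in_set[of "f i" ?A] by (simp add: \<sigma>_def)
  have "\<sigma> i < t" if "i < t" for i
  proof -
    have "{x \<in> ?A. x < f i} \<subset> ?A" using that by auto
    then have "card {x \<in> ?A. x < f i} < card ?A" by (intro psubset_card_mono) auto
    then show ?thesis using that inj by (simp add: \<sigma>_def card_image)
  qed
  moreover have "inj_on \<sigma> {0..<t}"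
  proof (rule inj_onI)
    fix x y assume "x \<in> {0..<t}" "y \<in> {0..<t}" "\<sigma> x = \<sigma> y"
    then show "x = y" using pk[of x] pk[of y] inj by (auto simp: inj_on_def)
  qed
  moreover from calculation have "\<sigma> ` {0..<t} = {0..<t}"
    by (intro endo_inj_surj) auto
  ultimately have "bij_betw \<sigma> {0..<t} {0..<t}"
    by (simp add: bij_betw_def)
  then have "\<sigma> permutes {0..<t}"
    by (rule bij_imp_permutes) (auto simp: \<sigma>_def)
  then show thesis using pk that by blast
qed

lemma minor_generic_matrix:
  assumes "A \<subseteq> {0..<m}" "B \<subseteq> {0..<n}" "card A = t" "card B = t"
  shows "det (submatrix (generic_matrix m n) A B) = zdet t (\<lambda>i. Suc (pick A i)) (\<lambda>j. Suc (pick B j))"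
proof -
  have "{i. i < m \<and> i \<in> A} = A" "{j. j < n \<and> j \<in> B} = B" using assms by auto
  moreover have "pick A i < m" if "i < t" for i
    using pick_in_set[of i A] that assms by fastforce
  moreover have "pick B i < n" if "i < t" for i
    using pick_in_set[of i B] that assms by fastforce
  ultimately show ?thesis
    unfolding zdet_def submatrix_def generic_matrix_def using assms
    by (intro arg_cong[of _ _ det] eq_matI) auto
qed

section \<open>The determinantal ideal\<close>

context
  fixes t m n :: nat and \<D> :: "'k::field zpoly set"
  defines "\<D> \<equiv> determinantal_ideal t m n"
begin

lemma minors_in_grid: "minors t (generic_matrix m n) \<subseteq> (polys_in (grid m n) :: 'k zpoly set)"
proof
  fix p :: "'k zpoly" assume "p \<in> minors t (generic_matrix m n)"
  then obtain A B where AB: "A \<subseteq> {0..<m}" "B \<subseteq> {0..<n}" "card A = t" "card B = t"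
    and p: "p = det (submatrix (generic_matrix m n) A B)"
    by (auto simp: minors_def generic_matrix_def)
  have "Suc (pick A i) \<in> {1..m}" "Suc (pick B i) \<in> {1..n}" if "i < t" for i
    using pick_in_set[of i A] pick_in_set[of i B] that AB by fastforce+
  then have "(\<lambda>i. Suc (pick A i)) ` {..<t} \<times> (\<lambda>i. Suc (pick B i)) ` {..<t} \<subseteq> grid m n"
    unfolding grid_def by blast
  then show "p \<in> polys_in (grid m n)"
    unfolding p minor_generic_matrix[OF AB]
    using polys_in_mono[of _ "grid m n"] zdet_in[of t "\<lambda>i. Suc (pick A i)" "\<lambda>i. Suc (pick B i)"] by blast
qed

lemma ideal_determinantal_ideal: "ideal \<D> (poly_ring_in (grid m n))"
proof -
  interpret cring "poly_ring_in (grid m n) :: 'k zpoly ring" by (rule cring_poly_ring_in)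
  show ?thesis unfolding \<D>_def determinantal_ideal_def
    by (rule genideal_ideal) (use minors_in_grid in \<open>simp add: poly_ring_in_def\<close>)
qed

lemma determinantal_ideal_0: "0 \<in> \<D>"
  using additive_subgroup.zero_closed[OF ideal.axioms(1)[OF ideal_determinantal_ideal]] by (simp add: poly_ring_in_def)

lemma determinantal_ideal_add: "p \<in> \<D> \<Longrightarrow> q \<in> \<D> \<Longrightarrow> p + q \<in> \<D>"
  using additive_subgroup.a_closed[OF ideal.axioms(1)[OF ideal_determinantal_ideal]] by (simp add: poly_ring_in_def)

lemma determinantal_ideal_mult: "p \<in> polys_in (grid m n) \<Longrightarrow> q \<in> \<D> \<Longrightarrow> p * q \<in> \<D>"
  using ideal.I_l_closed[OF ideal_determinantal_ideal] by (simp add: poly_ring_in_def)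

lemma determinantal_ideal_subset: "\<D> \<subseteq> polys_in (grid m n)"
  using additive_subgroup.a_subset[OF ideal.axioms(1)[OF ideal_determinantal_ideal]] by (simp add: poly_ring_in_def)

lemma determinantal_ideal_sum: "(\<And>i. i \<in> A \<Longrightarrow> f i \<in> \<D>) \<Longrightarrow> (\<Sum>i\<in>A. f i) \<in> \<D>"
  by (induction A rule: infinite_finite_induct) (auto simp: determinantal_ideal_0 determinantal_ideal_add)

lemma pick_minor_in_determinantal_ideal:
  assumes "A \<subseteq> {0..<m}" "B \<subseteq> {0..<n}" "card A = t" "card B = t"
  shows "zdet t (\<lambda>i. Suc (pick A i)) (\<lambda>j. Suc (pick B j)) \<in> \<D>"
proof -
  interpret cring "poly_ring_in (grid m n) :: 'k zpoly ring" by (rule cring_poly_ring_in)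
  have "minors t (generic_matrix m n) \<subseteq> \<D>" unfolding \<D>_def determinantal_ideal_def
    by (rule genideal_self) (use minors_in_grid in \<open>simp add: poly_ring_in_def\<close>)
  moreover have "zdet t (\<lambda>i. Suc (pick A i)) (\<lambda>j. Suc (pick B j)) \<in> minors t (generic_matrix m n)"
    using minor_generic_matrix[OF assms, symmetric] assms
    by (auto simp: minors_def generic_matrix_def)
  ultimately show ?thesis by blast
qed

text \<open>
The generators of the ideal have increasing rows and columns. An enumeration without repetition
differs from an increasing one by a permutation, which changes only the sign, and a repeated row
or column makes the determinant zero.
\<close>

lemma zdet_in_determinantal_ideal:
  assumes a: "a ` {..<t} \<subseteq> {1..m}" and b: "b ` {..<t} \<subseteq> {1..n}"
  shows "zdet t a b \<in> \<D>"
proof (cases "inj_on a {..<t} \<and> inj_on b {..<t}")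
  case False
  have "zdet t a b = (0 :: 'k zpoly)"
  proof -
    from False consider i j where "i < t" "j < t" "i \<noteq> j" "a i = a j"
      | i j where "i < t" "j < t" "i \<noteq> j" "b i = b j"
      by (auto simp: inj_on_def)
    then show ?thesis
    proof cases
      case 1
      then show ?thesis unfolding zdet_def
        by (intro det_identical_rows[OF mat_carrier, of i j]) (auto intro!: eq_vecI)
    next
      case 2
      then show ?thesis unfolding zdet_def
        by (intro det_identical_columns[OF mat_carrier, of i j]) (auto intro!: eq_vecI)
    qed
  qed
  then show ?thesis by (simp add: determinantal_ideal_0)
next
  case True
  let ?a = "\<lambda>i. a i - 1" and ?b = "\<lambda>i. b i - 1"
  have a': "a i \<ge> 1" "a i \<le> m" and b': "b i \<ge> 1" "b i \<le> n" if "i < t" for i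
    using a b that by force+
  have inj: "inj_on ?a {..<t}" "inj_on ?b {..<t}"
    using True a' b' by (fastforce simp: inj_on_def eq_diff_iff)+
  obtain \<sigma> where \<sigma>: "\<sigma> permutes {0..<t}" "\<And>i. i < t \<Longrightarrow> pick (?a ` {..<t}) (\<sigma> i) = ?a i"
    using inj_on_eq_pick_permute[OF inj(1)] by blast
  obtain \<tau> where \<tau>: "\<tau> permutes {0..<t}" "\<And>i. i < t \<Longrightarrow> pick (?b ` {..<t}) (\<tau> i) = ?b i"
    using inj_on_eq_pick_permute[OF inj(2)] by blast
  let ?F = "\<lambda>i j. zvar (Suc (pick (?a ` {..<t}) i), Suc (pick (?b ` {..<t}) j)) :: 'k zpoly"
  have "Suc (pick (?a ` {..<t}) (\<sigma> i)) = a i" "Suc (pick (?b ` {..<t}) (\<tau> i)) = b i" if "i < t" for i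
    using \<sigma>(2)[OF that] \<tau>(2)[OF that] a'[OF that] b'[OF that] by simp_all
  then have "zdet t a b = det (mat t t (\<lambda>(i, j). ?F (\<sigma> i) (\<tau> j)))"
    unfolding zdet_def by (intro arg_cong[of _ _ det] eq_matI) auto
  also have "\<dots> = signof \<sigma> * (signof \<tau> * det (mat t t (\<lambda>(i, j). ?F i j)))"
    using det_mat_permute_rows[OF \<sigma>(1), of "\<lambda>i j. ?F i (\<tau> j)"] det_mat_permute_cols[OF \<tau>(1), of ?F]
    by simp
  also have "\<dots> \<in> \<D>"
  proof (intro determinantal_ideal_mult polys_in_signof)
    have "?a i < m" "?b i < n" if "i < t" for i
      using a'[OF that] b'[OF that] by auto
    then have "zdet t (\<lambda>i. Suc (pick (?a ` {..<t}) i)) (\<lambda>j. Suc (pick (?b ` {..<t}) j)) \<in> \<D>"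
      using inj by (intro pick_minor_in_determinantal_ideal) (auto simp: card_image)
    then show "det (mat t t (\<lambda>(i, j). ?F i j)) \<in> \<D>"
      by (simp add: zdet_def)
  qed
  finally show ?thesis .
qed

lemma determinantal_ideal_minimal:
  assumes "K \<subseteq> polys_in (grid m n)" "0 \<in> K" "\<And>p q. p \<in> K \<Longrightarrow> q \<in> K \<Longrightarrow> p + q \<in> K"
    and mult: "\<And>p q. p \<in> polys_in (grid m n) \<Longrightarrow> q \<in> K \<Longrightarrow> p * q \<in> K"
    and minor: "\<And>a b. a ` {..<t} \<subseteq> {1..m} \<Longrightarrow> b ` {..<t} \<subseteq> {1..n} \<Longrightarrow> zdet t a b \<in> K"
  shows "\<D> \<subseteq> K"
proof -
  let ?R = "poly_ring_in (grid m n) :: 'k zpoly ring"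
  interpret cring ?R by (rule cring_poly_ring_in)
  have "subgroup K (add_monoid ?R)"
  proof
    fix x assume x: "x \<in> K"
    then have mx: "- x \<in> K" using mult[of "- 1" x] by (simp add: polys_in_uminus polys_in_1)
    have "\<ominus>\<^bsub>?R\<^esub> x = - x"
      by (rule minus_equality) (use x mx assms(1) in \<open>auto simp: poly_ring_in_def\<close>)
    then show "inv\<^bsub>add_monoid ?R\<^esub> x \<in> K" using mx by (simp add: a_inv_def)
  qed (use assms in \<open>auto simp: poly_ring_in_def\<close>)
  moreover have "q * p \<in> K" if "p \<in> polys_in (grid m n)" "q \<in> K" for p q
    using mult[OF that] by (simp only: mult.commute[of q])
  ultimately have "ideal K ?R"
    using mult by (intro idealI ring_axioms) (auto simp: poly_ring_in_def)
  moreover have "minors t (generic_matrix m n) \<subseteq> K"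
  proof
    fix p :: "'k zpoly" assume "p \<in> minors t (generic_matrix m n)"
    then obtain A B where AB: "A \<subseteq> {0..<m}" "B \<subseteq> {0..<n}" "card A = t" "card B = t"
      and p: "p = det (submatrix (generic_matrix m n) A B)"
      by (auto simp: minors_def generic_matrix_def)
    have "Suc (pick A i) \<in> {1..m}" "Suc (pick B i) \<in> {1..n}" if "i < t" for i
      using pick_in_set[of i A] pick_in_set[of i B] that AB by fastforce+
    then show "p \<in> K" unfolding p minor_generic_matrix[OF AB] by (intro minor) auto
  qed
  ultimately show ?thesis
    unfolding \<D>_def determinantal_ideal_def by (rule genideal_minimal)
qed

end

section \<open>Vanishing on matrices of bounded rank\<close>

definition matprod :: "nat \<Rightarrow> (nat \<Rightarrow> nat \<Rightarrow> 'k::field) \<Rightarrow> (nat \<Rightarrow> nat \<Rightarrow> 'k) \<Rightarrow> nat \<times> nat \<Rightarrow> 'k"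
  where "matprod r U V = (\<lambda>(i, j). \<Sum>l<r. U i l * V l j)"

text \<open>
The products \<open>U V\<close> with inner dimension \<open>r\<close> are the matrices of rank at most \<open>r\<close>. Parametrizing them
by \<open>U\<close> and \<open>V\<close> makes this variety the image of an affine space, in which two points are joined by a
line.
\<close>

definition vanishes_on_rank :: "nat \<Rightarrow> 'k::field zpoly \<Rightarrow> bool"
  where "vanishes_on_rank r p \<longleftrightarrow> (\<forall>U V. mpoly_value (matprod r U V) p = 0)"

definition polyfun :: "('k::field \<Rightarrow> 'k) \<Rightarrow> bool"
  where "polyfun g \<longleftrightarrow> (\<exists>q. \<forall>s. g s = poly q s)"

lemma polyfun_const: "polyfun (\<lambda>_. c)"
  unfolding polyfun_def by (intro exI[of _ "[:c:]"]) simp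

lemma polyfun_add: "polyfun f \<Longrightarrow> polyfun g \<Longrightarrow> polyfun (\<lambda>s. f s + g s)"
  unfolding polyfun_def by (metis poly_add)

lemma polyfun_mult: "polyfun f \<Longrightarrow> polyfun g \<Longrightarrow> polyfun (\<lambda>s. f s * g s)"
  unfolding polyfun_def by (metis poly_mult)

lemma polyfun_power: "polyfun f \<Longrightarrow> polyfun (\<lambda>s. f s ^ k)"
  unfolding polyfun_def by (metis poly_power)

lemma polyfun_sum: "(\<And>i. i \<in> A \<Longrightarrow> polyfun (f i)) \<Longrightarrow> polyfun (\<lambda>s. \<Sum>i\<in>A. f i s)"
  by (induction A rule: infinite_finite_induct) (auto intro: polyfun_const polyfun_add)

lemma polyfun_prod: "(\<And>i. i \<in> A \<Longrightarrow> polyfun (f i)) \<Longrightarrow> polyfun (\<lambda>s. \<Prod>i\<in>A. f i s)"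
  by (induction A rule: infinite_finite_induct) (auto intro: polyfun_const polyfun_mult)

lemma polyfun_line: "polyfun (\<lambda>s. c + s * d)"
  unfolding polyfun_def by (intro exI[of _ "[:c, d:]"]) simp

lemma polyfun_mpoly_value:
  "(\<And>v. polyfun (\<lambda>s. w s v)) \<Longrightarrow> polyfun (\<lambda>s. mpoly_value (w s) p)"
  unfolding mpoly_value_def monom_value_def
  by (intro polyfun_sum polyfun_mult polyfun_const polyfun_prod polyfun_power)

text \<open>
The polynomials vanishing on the matrices of rank at most \<open>r\<close> form a prime ideal. If neither factor
vanishes, take a parameter point where \<open>p\<close> is nonzero and one where \<open>q\<close> is nonzero. On the line
that joins them both become nonzero polynomials in one variable, and so does their product.
\<close>

lemma vanishes_on_rank_mult:
  fixes p q :: "'k::field zpoly"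
  assumes inf: "infinite (UNIV :: 'k set)" and pq: "vanishes_on_rank r (p * q)"
  shows "vanishes_on_rank r p \<or> vanishes_on_rank r q"
proof (rule ccontr)
  assume "\<not> ?thesis"
  then obtain U0 V0 U1 V1 where p: "mpoly_value (matprod r U0 V0) p \<noteq> 0"
    and q: "mpoly_value (matprod r U1 V1) q \<noteq> 0"
    unfolding vanishes_on_rank_def by blast
  \<comment> \<open>the line through the two parameter points, which are its points at \<open>s = 0\<close> and \<open>s = 1\<close>\<close>
  let ?w = "\<lambda>s. matprod r (\<lambda>i l. U0 i l + s * (U1 i l - U0 i l)) (\<lambda>l j. V0 l j + s * (V1 l j - V0 l j))"
  have w: "polyfun (\<lambda>s. ?w s v)" for v
    unfolding matprod_def case_prod_beta by (intro polyfun_sum polyfun_mult polyfun_line)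
  obtain P Q where P: "\<And>s. mpoly_value (?w s) p = poly P s" and Q: "\<And>s. mpoly_value (?w s) q = poly Q s"
    using polyfun_mpoly_value[of ?w, OF w] unfolding polyfun_def by metis
  have "poly (P * Q) s = 0" for s
    using pq unfolding vanishes_on_rank_def
    by (simp add: P[symmetric] Q[symmetric] mpoly_value_mult[symmetric])
  then have "P * Q = 0"
    using inf poly_roots_finite[of "P * Q"] by fastforce
  moreover have "poly P 0 \<noteq> 0" using p P[of 0] by simp
  moreover have "poly Q 1 \<noteq> 0" using q Q[of 1] by simp
  ultimately show False by auto
qed

lemma vanishes_on_rank_add: "vanishes_on_rank r p \<Longrightarrow> vanishes_on_rank r q \<Longrightarrow> vanishes_on_rank r (p + q)"
  by (simp add: vanishes_on_rank_def mpoly_value_add)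

lemma vanishes_on_rank_mult_left: "vanishes_on_rank r q \<Longrightarrow> vanishes_on_rank r (p * q)"
  by (simp add: vanishes_on_rank_def mpoly_value_mult)

lemma zdet_vanishes_on_rank: "vanishes_on_rank r (zdet (Suc r) a b :: 'k::field zpoly)"
  unfolding vanishes_on_rank_def
proof (intro allI)
  fix U V :: "nat \<Rightarrow> nat \<Rightarrow> 'k"
  \<comment> \<open>the factors padded to square matrices; the last column of \<open>A\<close> is zero\<close>
  define A where "A = mat (Suc r) (Suc r) (\<lambda>(p, l). if l < r then U (a p) l else 0)"
  define B where "B = mat (Suc r) (Suc r) (\<lambda>(l, q). V l (b q))"
  have carrier: "A \<in> carrier_mat (Suc r) (Suc r)" "B \<in> carrier_mat (Suc r) (Suc r)"
    by (auto simp: A_def B_def)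
  have "mat (Suc r) (Suc r) (\<lambda>(p, q). matprod r U V (a p, b q)) = A * B"
    by (rule eq_matI) (auto simp: A_def B_def matprod_def scalar_prod_def atLeast0LessThan)
  moreover have "det A = 0"
    unfolding laplace_expansion_column[OF carrier(1) lessI]
    by (rule sum.neutral) (simp add: A_def)
  ultimately show "mpoly_value (matprod r U V) (zdet (Suc r) a b) = 0"
    by (simp add: mpoly_value_zdet det_mult[OF carrier])
qed

text \<open>
The witness is the product of 0-1 matrices that is the identity on the chosen rows and columns.
\<close>

lemma zdet_not_vanishes_on_rank:
  assumes "inj_on a {..<r}" "inj_on b {..<r}"
  shows "\<not> vanishes_on_rank r (zdet r a b :: 'k::field zpoly)"
proof
  assume van: "vanishes_on_rank r (zdet r a b :: 'k zpoly)"
  define U :: "nat \<Rightarrow> nat \<Rightarrow> 'k" where "U i l = (if i = a l then 1 else 0)" for i l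
  define V :: "nat \<Rightarrow> nat \<Rightarrow> 'k" where "V l j = (if j = b l then 1 else 0)" for l j
  have "matprod r U V (a p, b q) = (if p = q then 1 else 0)" if pq: "p < r" "q < r" for p q
  proof -
    have "U (a p) l * V l (b q) = (if l = p then if p = q then 1 else 0 else 0)" if "l < r" for l
      using inj_on_eq_iff[OF assms(1), of p l] inj_on_eq_iff[OF assms(2), of q l] pq that
      by (simp add: U_def V_def)
    then have "matprod r U V (a p, b q) = (\<Sum>l<r. if l = p then if p = q then 1 else 0 else 0)"
      unfolding matprod_def prod.case by (intro sum.cong) (simp_all only: lessThan_iff)
    then show ?thesis using pq by simp
  qed
  then have "mat r r (\<lambda>(p, q). matprod r U V (a p, b q)) = 1\<^sub>m r"
    by (intro eq_matI) simp_all
  then have "mpoly_value (matprod r U V) (zdet r a b) = (1 :: 'k)"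
    by (simp only: mpoly_value_zdet det_one)
  then show False using van by (simp add: vanishes_on_rank_def)
qed

section \<open>A Nullstellensatz for the determinantal ideal\<close>

lemma prod_zvar_powers:
  "(\<Prod>v\<in>Poly_Mapping.keys t. zvar v ^ Poly_Mapping.lookup t v) = (Poly_Mapping.single t 1 :: 'k::field zpoly)"
proof -
  have pw: "zvar v ^ k = (Poly_Mapping.single (Poly_Mapping.single v k) 1 :: 'k zpoly)" for v k
    by (induction k) (auto simp: zvar_def mult_single simp flip: single_add)
  have "(\<Prod>v\<in>F. zvar v ^ Poly_Mapping.lookup t v) =
      (Poly_Mapping.single (\<Sum>v\<in>F. Poly_Mapping.single v (Poly_Mapping.lookup t v)) 1 :: 'k zpoly)" for F
    by (induction F rule: infinite_finite_induct) (auto simp: pw mult_single)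
  then show ?thesis using poly_eq_sum_monomials[of t] by simp
qed

text \<open>
The polynomial \<open>f\<close> at \<open>W / d\<close>, multiplied by \<open>d ^ N\<close> to clear the denominators. Every exponent of
\<open>d\<close> is a true difference if \<open>N\<close> bounds the total degree of \<open>f\<close>.
\<close>

definition homogenize :: "'k::field zpoly \<Rightarrow> nat \<Rightarrow> 'k zpoly \<Rightarrow> (nat \<times> nat \<Rightarrow> 'k zpoly) \<Rightarrow> 'k zpoly"
  where "homogenize f N d W = (\<Sum>t\<in>Poly_Mapping.keys f.
    Poly_Mapping.single 0 (Poly_Mapping.lookup f t) *
    (d ^ (N - (\<Sum>v\<in>Poly_Mapping.keys t. Poly_Mapping.lookup t v)) *
     (\<Prod>v\<in>Poly_Mapping.keys t. W v ^ Poly_Mapping.lookup t v)))"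

definition degree_le :: "'k::field zpoly \<Rightarrow> nat \<Rightarrow> bool"
  where "degree_le f N \<longleftrightarrow> (\<forall>t\<in>Poly_Mapping.keys f. (\<Sum>v\<in>Poly_Mapping.keys t. Poly_Mapping.lookup t v) \<le> N)"

lemma degree_le_exists: "\<exists>N. degree_le f N"
  unfolding degree_le_def
  by (rule exI[of _ "\<Sum>t\<in>Poly_Mapping.keys f. \<Sum>v\<in>Poly_Mapping.keys t. Poly_Mapping.lookup t v"])
    (auto intro!: member_le_sum)

lemma mpoly_value_homogenize:
  assumes "degree_le f N" "mpoly_value w d \<noteq> 0"
  shows "mpoly_value w (homogenize f N d W) =
    mpoly_value w d ^ N * mpoly_value (\<lambda>v. mpoly_value w (W v) / mpoly_value w d) f"
proof -
  let ?d = "mpoly_value w d" and ?n = "\<lambda>t. \<Sum>v\<in>Poly_Mapping.keys t. Poly_Mapping.lookup t v"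
  have "?d ^ (N - ?n t) * (\<Prod>v\<in>Poly_Mapping.keys t. mpoly_value w (W v) ^ Poly_Mapping.lookup t v) =
      ?d ^ N * monom_value (\<lambda>v. mpoly_value w (W v) / ?d) t" if "t \<in> Poly_Mapping.keys f" for t
  proof -
    have "?n t \<le> N" using assms(1) that by (auto simp: degree_le_def)
    then have "?d ^ N = ?d ^ (N - ?n t) * ?d ^ ?n t" by (simp flip: power_add)
    moreover have "?d ^ ?n t * monom_value (\<lambda>v. mpoly_value w (W v) / ?d) t =
        (\<Prod>v\<in>Poly_Mapping.keys t. mpoly_value w (W v) ^ Poly_Mapping.lookup t v)"
      unfolding monom_value_def power_sum prod.distrib[symmetric]
      using assms(2) by (simp add: power_divide)
    ultimately show ?thesis by (simp add: mult.assoc)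
  qed
  then show ?thesis
    unfolding homogenize_def mpoly_value_def[of _ f] sum_distrib_left
    by (auto simp: mpoly_value_mult mpoly_value.hom_power mpoly_value.hom_prod mpoly_value_sum intro!: sum.cong)
qed

lemma homogenize_zvar:
  assumes "degree_le f N"
  shows "homogenize f N d (\<lambda>v. d * zvar v) = d ^ N * f"
proof -
  let ?n = "\<lambda>t. \<Sum>v\<in>Poly_Mapping.keys t. Poly_Mapping.lookup t v"
  have "d ^ (N - ?n t) * (\<Prod>v\<in>Poly_Mapping.keys t. (d * zvar v) ^ Poly_Mapping.lookup t v) =
      d ^ N * Poly_Mapping.single t 1" if "t \<in> Poly_Mapping.keys f" for t
  proof -
    have "?n t \<le> N" using assms(1) that by (auto simp: degree_le_def)
    then have "d ^ N = d ^ (N - ?n t) * d ^ ?n t" by (simp flip: power_add)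
    then show ?thesis
      unfolding prod_zvar_powers[symmetric]
      by (simp add: power_mult_distrib prod.distrib mult.assoc power_sum)
  qed
  then have "homogenize f N d (\<lambda>v. d * zvar v) = (\<Sum>t\<in>Poly_Mapping.keys f.
      d ^ N * (Poly_Mapping.single 0 (Poly_Mapping.lookup f t) * Poly_Mapping.single t 1))"
    unfolding homogenize_def by (intro sum.cong) (auto simp: mult.left_commute)
  also have "\<dots> = d ^ N * f"
    unfolding sum_distrib_left[symmetric] mult_single by (simp flip: poly_eq_sum_monomials)
  finally show ?thesis .
qed

lemma determinantal_ideal_mult_cong:
  assumes "p - p' \<in> determinantal_ideal t m n" "q - q' \<in> determinantal_ideal t m n"
    "p \<in> polys_in (grid m n)" "q' \<in> polys_in (grid m n)"
  shows "p * q - p' * q' \<in> determinantal_ideal t m n"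
proof -
  have "p * q - p' * q' = p * (q - q') + q' * (p - p')" by (simp add: algebra_simps)
  then show ?thesis using assms by (auto intro: determinantal_ideal_add determinantal_ideal_mult)
qed

lemma determinantal_ideal_power_cong:
  assumes "p - p' \<in> determinantal_ideal t m n" "p \<in> polys_in (grid m n)" "p' \<in> polys_in (grid m n)"
  shows "p ^ k - p' ^ k \<in> determinantal_ideal t m n"
  using assms by (induction k) (auto simp: determinantal_ideal_0 intro!: determinantal_ideal_mult_cong polys_in_power)

lemma determinantal_ideal_prod_cong:
  assumes "\<And>i. i \<in> A \<Longrightarrow> p i - p' i \<in> determinantal_ideal t m n"
    "\<And>i. i \<in> A \<Longrightarrow> p i \<in> polys_in (grid m n)" "\<And>i. i \<in> A \<Longrightarrow> p' i \<in> polys_in (grid m n)"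
  shows "(\<Prod>i\<in>A. p i) - (\<Prod>i\<in>A. p' i) \<in> determinantal_ideal t m n"
  using assms by (induction A rule: infinite_finite_induct) (auto simp: determinantal_ideal_0 intro!: determinantal_ideal_mult_cong polys_in_prod)

lemma homogenize_cong:
  assumes f: "f \<in> polys_in (grid m n)" and d: "d \<in> polys_in (grid m n)"
    and W: "\<And>v. v \<in> grid m n \<Longrightarrow> W v \<in> polys_in (grid m n)" "\<And>v. v \<in> grid m n \<Longrightarrow> W' v \<in> polys_in (grid m n)"
    and cong: "\<And>v. v \<in> grid m n \<Longrightarrow> W v - W' v \<in> determinantal_ideal t m n"
  shows "homogenize f N d W - homogenize f N d W' \<in> determinantal_ideal t m n"
  unfolding homogenize_def sum_subtractf[symmetric] right_diff_distrib[symmetric]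
proof (intro determinantal_ideal_sum determinantal_ideal_mult polys_in_single_0 polys_in_power d determinantal_ideal_prod_cong determinantal_ideal_power_cong)
  fix s v assume "s \<in> Poly_Mapping.keys f" "v \<in> Poly_Mapping.keys s"
  then have "v \<in> grid m n" using f by (auto simp: polys_in_def)
  then show "W v - W' v \<in> determinantal_ideal t m n" "W v \<in> polys_in (grid m n)" "W' v \<in> polys_in (grid m n)"
    "W v \<in> polys_in (grid m n)" "W' v \<in> polys_in (grid m n)"
    using W cong by auto
qed

text \<open>
By the bordered minors, \<open>d z\<^sub>i\<^sub>j\<close> is congruent to an entry \<open>W\<^sub>i\<^sub>j\<close> of a product with inner dimension
\<open>t \<le> r\<close>, where \<open>d\<close> is the given minor. Clearing denominators in \<open>f\<close>, its value at \<open>W / d\<close> is therefore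
congruent to \<open>d ^ N * f\<close>. At a point where \<open>d\<close> is nonzero, \<open>W / d\<close> is a matrix of rank at most \<open>r\<close>
and \<open>f\<close> vanishes there. One more factor \<open>d\<close> takes care of the points where \<open>d\<close> is zero, and the
product then vanishes everywhere, so it is the zero polynomial.
\<close>

lemma minor_power_mult_in_ideal:
  fixes f :: "'k::field zpoly"
  assumes inf: "infinite (UNIV :: 'k set)" and f: "vanishes_on_rank r f" "f \<in> polys_in (grid m n)"
    and t: "t \<le> r" and a: "a ` {..<t} \<subseteq> {1..m}" and b: "b ` {..<t} \<subseteq> {1..n}"
  shows "\<exists>M. zdet t a b ^ M * f \<in> determinantal_ideal (Suc t) m n"
proof -
  let ?d = "zdet t a b :: 'k zpoly"
  let ?W = "\<lambda>(i, j). - (\<Sum>p<t. border_cofactor t a b i p * zvar (a p, j)) :: 'k zpoly"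
  obtain N where N: "degree_le f N" using degree_le_exists by blast
  have d: "?d \<in> polys_in (grid m n)"
    using zdet_in[of t a b] polys_in_mono[of "a ` {..<t} \<times> b ` {..<t}" "grid m n"] a b
    unfolding grid_def by blast
  have W: "?W v \<in> polys_in (grid m n)" if v: "v \<in> grid m n" for v
  proof -
    obtain i j where ij: "v = (i, j)" by force
    have "insert i (a ` {..<t}) \<times> b ` {..<t} \<subseteq> grid m n"
      using a b v by (auto simp: ij grid_def)
    then have "border_cofactor t a b i p * zvar (a p, j) \<in> polys_in (grid m n)" if "p < t" for p
      using border_cofactor_in[OF that, of a b i] polys_in_mono a v that
      by (intro polys_in_mult polys_in_zvar) (auto simp: ij grid_def)
    then show ?thesis unfolding ij by (auto intro!: polys_in_uminus polys_in_sum)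
  qed
  have cong: "?d * zvar v - ?W v \<in> determinantal_ideal (Suc t) m n" if v: "v \<in> grid m n" for v
  proof -
    obtain i j where ij: "v = (i, j)" by force
    have "zdet (Suc t) (a(t := i)) (b(t := j)) \<in> (determinantal_ideal (Suc t) m n :: 'k zpoly set)"
      using a b v by (intro zdet_in_determinantal_ideal) (auto simp: ij grid_def less_Suc_eq)
    then show ?thesis by (simp add: ij zdet_bordered)
  qed
  have "?d * homogenize f N ?d ?W = 0"
  proof (rule mpoly_value_eq_0_imp[OF inf])
    fix w
    show "mpoly_value w (?d * homogenize f N ?d ?W) = 0"
    proof (cases "mpoly_value w ?d = 0")
      case False
      let ?U = "\<lambda>i l. if l < t then - mpoly_value w (border_cofactor t a b i l) / mpoly_value w ?d else 0"
      let ?V = "\<lambda>l j. w (a l, j)"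
      have "mpoly_value w (?W v) / mpoly_value w ?d = matprod r ?U ?V v" for v
      proof -
        obtain i j where ij: "v = (i, j)" by force
        have "matprod r ?U ?V (i, j) = (\<Sum>l<t. ?U i l * ?V l j)"
          unfolding matprod_def prod.case using t by (intro sum.mono_neutral_right) auto
        then show ?thesis
          by (simp add: ij mpoly_value_sum mpoly_value_mult mpoly_value.hom_uminus sum_divide_distrib sum_negf)
      qed
      then show ?thesis
        using f(1) by (simp add: mpoly_value_mult mpoly_value_homogenize[OF N False] vanishes_on_rank_def)
    qed (simp add: mpoly_value_mult)
  qed
  moreover have "?d ^ N * f - homogenize f N ?d ?W \<in> determinantal_ideal (Suc t) m n"
    unfolding homogenize_zvar[OF N, symmetric]
    by (rule homogenize_cong) (use f d W cong in \<open>auto intro: polys_in_mult polys_in_zvar\<close>)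
  ultimately have "?d ^ Suc N * f \<in> determinantal_ideal (Suc t) m n"
    using determinantal_ideal_mult[OF d, of "?d ^ N * f - homogenize f N ?d ?W"]
    by (simp add: right_diff_distrib mult.assoc)
  then show ?thesis by blast
qed

text \<open>
The elements having a power that multiplies \<open>f\<close> into the ideal of \<open>t'\<close>-minors form an ideal: for a
sum, expand a high power by the binomial theorem. This ideal contains the \<open>t\<close>-minors.
\<close>

lemma power_mult_in_ideal_of_minors:
  fixes f g :: "'k::field zpoly"
  assumes minors: "\<And>a b. a ` {..<t} \<subseteq> {1..m} \<Longrightarrow> b ` {..<t} \<subseteq> {1..n} \<Longrightarrow>
      \<exists>M. zdet t a b ^ M * f \<in> determinantal_ideal t' m n"
    and f: "f \<in> polys_in (grid m n)" and g: "g \<in> determinantal_ideal t m n"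
  shows "\<exists>M. g ^ M * f \<in> determinantal_ideal t' m n"
proof -
  let ?D = "determinantal_ideal t' m n :: 'k zpoly set"
  let ?K = "{g \<in> polys_in (grid m n). \<exists>M. g ^ M * f \<in> ?D}"
  have "determinantal_ideal t m n \<subseteq> ?K"
  proof (rule determinantal_ideal_minimal)
    show "0 \<in> ?K" by (auto simp: polys_in_0 determinantal_ideal_0 intro!: exI[of _ 1])
  next
    fix p q assume pq: "p \<in> ?K" "q \<in> ?K"
    then obtain M1 M2 where M: "p ^ M1 * f \<in> ?D" "q ^ M2 * f \<in> ?D" by blast
    have "of_nat (M1 + M2 choose k) * p ^ k * q ^ (M1 + M2 - k) * f \<in> ?D" for k
    proof (cases "M1 \<le> k")
      case True
      then have "p ^ k = p ^ (k - M1) * p ^ M1" by (simp flip: power_add)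
      then have "of_nat (M1 + M2 choose k) * p ^ k * q ^ (M1 + M2 - k) * f
        = (of_nat (M1 + M2 choose k) * (p ^ (k - M1) * q ^ (M1 + M2 - k))) * (p ^ M1 * f)"
        by (simp add: mult_ac)
      also have "\<dots> \<in> ?D" using pq M
        by (intro determinantal_ideal_mult[OF _ M(1)] polys_in_mult polys_in_power polys_in_of_nat) auto
      finally show ?thesis .
    next
      case False
      then have "q ^ (M1 + M2 - k) = q ^ (M1 - k) * q ^ M2" by (simp flip: power_add)
      then have "of_nat (M1 + M2 choose k) * p ^ k * q ^ (M1 + M2 - k) * f
        = (of_nat (M1 + M2 choose k) * (p ^ k * q ^ (M1 - k))) * (q ^ M2 * f)"
        by (simp add: mult_ac)
      also have "\<dots> \<in> ?D" using pq M
        by (intro determinantal_ideal_mult[OF _ M(2)] polys_in_mult polys_in_power polys_in_of_nat) auto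
      finally show ?thesis .
    qed
    then have "(p + q) ^ (M1 + M2) * f \<in> ?D"
      unfolding binomial_ring sum_distrib_right by (intro determinantal_ideal_sum)
    then show "p + q \<in> ?K" using pq polys_in_add by blast
  next
    fix p q :: "'k zpoly" assume p: "p \<in> polys_in (grid m n)" and q: "q \<in> ?K"
    then obtain M where "q ^ M * f \<in> ?D" by blast
    then have "(p * q) ^ M * f \<in> ?D"
      using p by (auto simp: power_mult_distrib mult.assoc intro: determinantal_ideal_mult polys_in_power)
    then show "p * q \<in> ?K" using p q polys_in_mult by blast
  next
    fix a b :: "nat \<Rightarrow> nat" assume ab: "a ` {..<t} \<subseteq> {1..m}" "b ` {..<t} \<subseteq> {1..n}"
    have "zdet t a b \<in> (polys_in (grid m n) :: 'k zpoly set)"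
      using zdet_in_determinantal_ideal[OF ab] determinantal_ideal_subset by blast
    then show "zdet t a b \<in> ?K" using minors[OF ab] by simp
  qed auto
  then show ?thesis using g by blast
qed

lemma vanishes_on_rank_imp_power_in_determinantal_ideal:
  fixes f :: "'k::field zpoly"
  assumes inf: "infinite (UNIV :: 'k set)" and f: "vanishes_on_rank r f" "f \<in> polys_in (grid m n)"
  shows "\<exists>M. f ^ M \<in> determinantal_ideal (r + 1) m n"
proof -
  have "t \<le> r + 1 \<Longrightarrow> \<exists>M. f ^ M \<in> determinantal_ideal t m n" for t
  proof (induction t)
    case 0
    have "zdet 0 id id \<in> (determinantal_ideal 0 m n :: 'k zpoly set)" by (rule zdet_in_determinantal_ideal) auto
    then have "f ^ 0 \<in> determinantal_ideal 0 m n" by (simp add: zdet_def)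
    then show ?case by blast
  next
    case (Suc t)
    then obtain M where M: "f ^ M \<in> determinantal_ideal t m n" by auto
    have "\<exists>K. (f ^ M) ^ K * f \<in> determinantal_ideal (Suc t) m n"
      by (rule power_mult_in_ideal_of_minors[OF minor_power_mult_in_ideal[OF inf f] f(2) M])
        (use Suc.prems in auto)
    then show ?case by (metis power_Suc2 power_mult)
  qed
  then show ?thesis by blast
qed

section \<open>Entries that are rational functions of other entries\<close>

text \<open>
On the matrices of rank at most \<open>r\<close>, the polynomial \<open>q\<close> is a quotient of polynomials in the variables
of \<open>Y\<close>. By primality these \<open>q\<close> behave like the elements of a subfield: sums, products and quotients
with nonvanishing denominator are again such.
\<close>

definition rational_over :: "nat \<Rightarrow> (nat \<times> nat) set \<Rightarrow> 'k::field zpoly \<Rightarrow> bool"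
  where "rational_over r Y q \<longleftrightarrow> (\<exists>D\<in>polys_in Y. \<exists>P\<in>polys_in Y. \<not> vanishes_on_rank r D \<and>
    vanishes_on_rank r (D * q - P))"

lemma vanishes_on_rank_diff_iff:
  "vanishes_on_rank r (p - q) \<longleftrightarrow> (\<forall>U V. mpoly_value (matprod r U V) p = mpoly_value (matprod r U V) q)"
  by (simp add: vanishes_on_rank_def mpoly_value.hom_minus)

lemma not_vanishes_on_rank_1: "\<not> vanishes_on_rank r (1 :: 'k::field zpoly)"
  by (simp add: vanishes_on_rank_def)

lemma rational_over_mono: "rational_over r Y q \<Longrightarrow> Y \<subseteq> Y' \<Longrightarrow> rational_over r Y' q"
  unfolding rational_over_def using polys_in_mono by blast

lemma rational_over_polys_in: "q \<in> polys_in Y \<Longrightarrow> rational_over r Y q"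
  unfolding rational_over_def
  by (intro bexI[of _ 1] bexI[of _ q]) (auto simp: polys_in_1 not_vanishes_on_rank_1 vanishes_on_rank_def)

context
  assumes inf: "infinite (UNIV :: 'k::field set)"
begin

lemma rational_over_add:
  fixes p q :: "'k zpoly"
  assumes "rational_over r Y p" "rational_over r Y q"
  shows "rational_over r Y (p + q)"
proof -
  obtain D1 P1 D2 P2 where D: "D1 \<in> polys_in Y" "P1 \<in> polys_in Y" "\<not> vanishes_on_rank r D1"
    "D2 \<in> polys_in Y" "P2 \<in> polys_in Y" "\<not> vanishes_on_rank r D2"
    and eq: "vanishes_on_rank r (D1 * p - P1)" "vanishes_on_rank r (D2 * q - P2)"
    using assms unfolding rational_over_def by blast
  have "D1 * D2 * (p + q) - (D2 * P1 + D1 * P2) = D2 * (D1 * p - P1) + D1 * (D2 * q - P2)"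
    by (simp add: algebra_simps)
  then have "vanishes_on_rank r (D1 * D2 * (p + q) - (D2 * P1 + D1 * P2))"
    using eq by (simp add: vanishes_on_rank_add vanishes_on_rank_mult_left)
  moreover have "\<not> vanishes_on_rank r (D1 * D2)"
    using D vanishes_on_rank_mult[OF inf] by blast
  ultimately show ?thesis
    unfolding rational_over_def using D
    by (intro bexI[of _ "D1 * D2"] bexI[of _ "D2 * P1 + D1 * P2"] conjI polys_in_mult polys_in_add)
qed

lemma rational_over_mult:
  fixes p q :: "'k zpoly"
  assumes "rational_over r Y p" "rational_over r Y q"
  shows "rational_over r Y (p * q)"
proof -
  obtain D1 P1 D2 P2 where D: "D1 \<in> polys_in Y" "P1 \<in> polys_in Y" "\<not> vanishes_on_rank r D1"
    "D2 \<in> polys_in Y" "P2 \<in> polys_in Y" "\<not> vanishes_on_rank r D2"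
    and eq: "vanishes_on_rank r (D1 * p - P1)" "vanishes_on_rank r (D2 * q - P2)"
    using assms unfolding rational_over_def by blast
  have "D1 * D2 * (p * q) - P1 * P2 = D2 * q * (D1 * p - P1) + P1 * (D2 * q - P2)"
    by (simp add: algebra_simps)
  then have "vanishes_on_rank r (D1 * D2 * (p * q) - P1 * P2)"
    using eq by (simp only: vanishes_on_rank_add vanishes_on_rank_mult_left)
  moreover have "\<not> vanishes_on_rank r (D1 * D2)"
    using D vanishes_on_rank_mult[OF inf] by blast
  ultimately show ?thesis
    unfolding rational_over_def using D
    by (intro bexI[of _ "D1 * D2"] bexI[of _ "P1 * P2"] conjI polys_in_mult)
qed

lemma rational_over_divide:
  fixes p d z :: "'k zpoly"
  assumes "rational_over r Y p" "rational_over r Y d" "\<not> vanishes_on_rank r d"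
    and dz: "vanishes_on_rank r (d * z - p)"
  shows "rational_over r Y z"
proof -
  obtain D1 P1 D2 P2 where D: "D1 \<in> polys_in Y" "P1 \<in> polys_in Y" "\<not> vanishes_on_rank r D1"
    "D2 \<in> polys_in Y" "P2 \<in> polys_in Y" "\<not> vanishes_on_rank r D2"
    and eq: "vanishes_on_rank r (D1 * d - P1)" "vanishes_on_rank r (D2 * p - P2)"
    using assms unfolding rational_over_def by blast
  have "\<not> vanishes_on_rank r P1"
  proof
    assume "vanishes_on_rank r P1"
    from vanishes_on_rank_add[OF eq(1) this] have "vanishes_on_rank r (D1 * d)"
      by simp
    then show False using D(3) assms(3) vanishes_on_rank_mult[OF inf] by blast
  qed
  then have "\<not> vanishes_on_rank r (D2 * P1)"
    using D vanishes_on_rank_mult[OF inf] by blast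
  moreover have "D2 * P1 * z - D1 * P2 =
      D1 * D2 * (d * z - p) + (- D2 * z * (D1 * d - P1) + D1 * (D2 * p - P2))"
    by (simp add: algebra_simps)
  then have "vanishes_on_rank r (D2 * P1 * z - D1 * P2)"
    using eq dz by (simp only: vanishes_on_rank_add vanishes_on_rank_mult_left)
  ultimately show ?thesis
    unfolding rational_over_def using D
    by (intro bexI[of _ "D2 * P1"] bexI[of _ "D1 * P2"] conjI polys_in_mult)
qed

text \<open>
Every polynomial is obtained from constants and its variables by sums and products.
\<close>

lemma rational_over_trans:
  fixes q :: "'k zpoly"
  assumes q: "q \<in> polys_in X" and X: "\<And>x. x \<in> X \<Longrightarrow> rational_over r Y (zvar x :: 'k zpoly)"
  shows "rational_over r Y q"
proof -
  have const: "rational_over r Y (Poly_Mapping.single 0 c :: 'k zpoly)" for c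
    by (rule rational_over_polys_in) simp
  have one: "rational_over r Y (1 :: 'k zpoly)" by (rule rational_over_polys_in[OF polys_in_1])
  have sum: "rational_over r Y (\<Sum>i\<in>A. f i)" if "\<And>i. i \<in> A \<Longrightarrow> rational_over r Y (f i :: 'k zpoly)" for A :: "'i set" and f
    using that by (induction A rule: infinite_finite_induct)
      (auto intro: rational_over_add rational_over_polys_in polys_in_0)
  have prod: "rational_over r Y (\<Prod>i\<in>A. f i)" if "\<And>i. i \<in> A \<Longrightarrow> rational_over r Y (f i :: 'k zpoly)" for A :: "'i set" and f
    using that by (induction A rule: infinite_finite_induct) (auto intro: rational_over_mult one)
  have power: "rational_over r Y (p ^ k)" if "rational_over r Y p" for p :: "'k zpoly" and k
    using that by (induction k) (auto intro: rational_over_mult one)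
  have "q = (\<Sum>t\<in>Poly_Mapping.keys q. Poly_Mapping.single 0 (Poly_Mapping.lookup q t) *
      (\<Prod>v\<in>Poly_Mapping.keys t. zvar v ^ Poly_Mapping.lookup t v))"
    unfolding prod_zvar_powers mult_single by (simp flip: poly_eq_sum_monomials)
  also have "rational_over r Y \<dots>"
    by (intro sum rational_over_mult const prod power X) (use q in \<open>auto simp: polys_in_def\<close>)
  finally show ?thesis .
qed

text \<open>
Solve the vanishing bordered minor for the entry \<open>(i, j)\<close>. The denominator is the minor on \<open>A \<times> B\<close>,
which is not zero on the whole variety, and every other variable that occurs lies in the cross.
\<close>

lemma rational_over_cross:
  assumes fin: "finite A" "finite B" and card: "card A = r" "card B = r"
    and AB: "A \<subseteq> I" "B \<subseteq> J" and ij: "i \<in> I" "j \<in> J"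
    and cross: "\<And>x. x \<in> A \<times> J \<union> I \<times> B \<Longrightarrow> rational_over r Y (zvar x :: 'k zpoly)"
  shows "rational_over r Y (zvar (i, j) :: 'k zpoly)"
proof -
  obtain a where a: "bij_betw a {..<r} A"
    using ex_bij_betw_nat_finite[OF fin(1)] card by (auto simp: atLeast0LessThan)
  obtain b where b: "bij_betw b {..<r} B"
    using ex_bij_betw_nat_finite[OF fin(2)] card by (auto simp: atLeast0LessThan)
  let ?W = "- (\<Sum>p<r. border_cofactor r a b i p * zvar (a p, j)) :: 'k zpoly"
  have img: "a ` {..<r} = A" "b ` {..<r} = B" using a b by (auto simp: bij_betw_def)
  show ?thesis
  proof (rule rational_over_divide)
    have "zdet r a b * zvar (i, j) - ?W = zdet (Suc r) (a(r := i)) (b(r := j))"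
      by (simp add: zdet_bordered)
    then show "vanishes_on_rank r (zdet r a b * zvar (i, j) - ?W)"
      by (simp only: zdet_vanishes_on_rank)
    show "\<not> vanishes_on_rank r (zdet r a b :: 'k zpoly)"
      using a b by (intro zdet_not_vanishes_on_rank) (auto simp: bij_betw_def)
    show "rational_over r Y (zdet r a b :: 'k zpoly)"
      by (rule rational_over_trans[OF zdet_in cross]) (use img AB in auto)
    have "border_cofactor r a b i p * zvar (a p, j) \<in> (polys_in (A \<times> J \<union> I \<times> B) :: 'k zpoly set)"
      if "p < r" for p
    proof (intro polys_in_mult polys_in_zvar)
      have "insert i (a ` {..<r}) \<times> b ` {..<r} \<subseteq> A \<times> J \<union> I \<times> B"
        using img AB ij by auto
      then show "border_cofactor r a b i p \<in> (polys_in (A \<times> J \<union> I \<times> B) :: 'k zpoly set)"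
        using border_cofactor_in[OF that] polys_in_mono by blast
      show "(a p, j) \<in> A \<times> J \<union> I \<times> B" using img ij that by auto
    qed
    then show "rational_over r Y ?W"
      by (intro rational_over_trans[OF _ cross] polys_in_uminus polys_in_sum) auto
  qed
qed

text \<open>
If \<open>I'\<close> has at most \<open>r\<close> elements, choose the \<open>r\<close> rows \<open>A\<close> to contain \<open>I \<inter> I'\<close>; otherwise choose the
\<open>r\<close> columns \<open>B\<close> to contain \<open>J \<inter> J'\<close>. Then the entries in \<open>(I - A) \<times> (J - B)\<close> are all new. They need not
be added to the spanning set, since the cross determines them.
\<close>

lemma spanning_set_add_block:
  assumes fin: "finite X" "finite I" "finite J" "finite I'" "finite J'"
    and Y: "Y \<subseteq> X" "card Y + c \<le> card X" "\<And>x. x \<in> X \<Longrightarrow> rational_over r Y (zvar x :: 'k zpoly)"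
    and IJ: "r \<le> card I" "r \<le> card J"
    and overlap: "(I \<times> J) \<inter> X \<subseteq> I' \<times> J'" "min (card I') (card J') \<le> r"
  obtains Y' where "Y' \<subseteq> X \<union> I \<times> J"
    "card Y' + (c + (card I - r) * (card J - r)) \<le> card (X \<union> I \<times> J)"
    "\<And>x. x \<in> X \<union> I \<times> J \<Longrightarrow> rational_over r Y' (zvar x :: 'k zpoly)"
proof -
  have ex: "\<exists>A. S \<subseteq> A \<and> A \<subseteq> K \<and> card A = r" if "S \<subseteq> K" "card S \<le> r" "r \<le> card K" "finite K" for S K :: "nat set"
    using exists_subset_between[OF that(2,3,1,4)] by blast
  obtain A B where AB: "A \<subseteq> I" "B \<subseteq> J" "card A = r" "card B = r"
    and T: "((I - A) \<times> (J - B)) \<inter> X = {}"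
  proof (cases "card I' \<le> r")
    case True
    then have "card (I \<inter> I') \<le> r"
      using card_mono[OF fin(4), of "I \<inter> I'"] by simp
    then obtain A where "I \<inter> I' \<subseteq> A" "A \<subseteq> I" "card A = r"
      using ex[of "I \<inter> I'" I] IJ fin by auto
    moreover obtain B where "B \<subseteq> J" "card B = r" using ex[of "{}" J] IJ fin by auto
    ultimately show ?thesis using overlap(1) by (intro that[of A B]) auto
  next
    case False
    then have "card J' \<le> r" using overlap(2) by simp
    then have "card (J \<inter> J') \<le> r"
      using card_mono[OF fin(5), of "J \<inter> J'"] by simp
    then obtain B where "J \<inter> J' \<subseteq> B" "B \<subseteq> J" "card B = r"
      using ex[of "J \<inter> J'" J] IJ fin by auto
    moreover obtain A where "A \<subseteq> I" "card A = r" using ex[of "{}" I] IJ fin by auto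
    ultimately show ?thesis using overlap(1) by (intro that[of A B]) auto
  qed
  let ?T = "(I - A) \<times> (J - B)"
  let ?Y = "Y \<union> ((I \<times> J - X) - ?T)"
  have finAB: "finite A" "finite B" using AB fin finite_subset by auto
  show thesis
  proof (rule that[of ?Y])
    show "?Y \<subseteq> X \<union> I \<times> J" using Y by auto
    have "card ?T = (card I - r) * (card J - r)"
      using AB finAB by (simp add: card_cartesian_product card_Diff_subset)
    moreover have "?T \<subseteq> I \<times> J - X" using T by auto
    ultimately have "card ((I \<times> J - X) - ?T) + (card I - r) * (card J - r) = card (I \<times> J - X)"
      using fin card_mono[of "I \<times> J - X" ?T] by (simp add: card_Diff_subset)
    moreover have "card (X \<union> I \<times> J) = card X + card (I \<times> J - X)"
      using fin by (subst card_Un_disjoint[symmetric]) auto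
    ultimately show "card ?Y + (c + (card I - r) * (card J - r)) \<le> card (X \<union> I \<times> J)"
      using Y(2) card_Un_le[of Y "(I \<times> J - X) - ?T"] by linarith
    have base: "rational_over r ?Y (zvar x :: 'k zpoly)" if "x \<in> X \<union> (I \<times> J - ?T)" for x
    proof (cases "x \<in> X")
      case True
      then show ?thesis using rational_over_mono[OF Y(3)] by blast
    next
      case False
      then show ?thesis using that by (intro rational_over_polys_in polys_in_zvar) auto
    qed
    show "rational_over r ?Y (zvar x :: 'k zpoly)" if x: "x \<in> X \<union> I \<times> J" for x
    proof (cases "x \<in> X")
      case False
      then obtain i j where ij: "x = (i, j)" "i \<in> I" "j \<in> J" using x by auto
      have "A \<times> J \<union> I \<times> B \<subseteq> X \<union> (I \<times> J - ?T)" using AB by blast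
      then show ?thesis
        unfolding ij(1) by (intro rational_over_cross[OF finAB AB(3,4,1,2) ij(2,3)] base) blast
    qed (use base in auto)
  qed
qed

lemma spanning_set_of_blocks:
  fixes I J :: "nat \<Rightarrow> nat set"
  assumes block: "\<And>\<alpha>. \<alpha> \<in> {1..s} \<Longrightarrow>
      finite (I \<alpha>) \<and> finite (J \<alpha>) \<and> r \<le> card (I \<alpha>) \<and> r \<le> card (J \<alpha>)"
    and overlap: "\<And>\<alpha>. \<alpha> \<in> {1..s} \<Longrightarrow> \<exists>I' J'. finite I' \<and> finite J' \<and>
      (I \<alpha> \<times> J \<alpha>) \<inter> (\<Union>k\<in>{1..<\<alpha>}. I k \<times> J k) \<subseteq> I' \<times> J' \<and> min (card I') (card J') \<le> r"
  shows "\<exists>Y. Y \<subseteq> (\<Union>\<alpha>\<in>{1..s}. I \<alpha> \<times> J \<alpha>) \<and>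
    card Y + (\<Sum>\<alpha>=1..s. (card (I \<alpha>) - r) * (card (J \<alpha>) - r)) \<le> card (\<Union>\<alpha>\<in>{1..s}. I \<alpha> \<times> J \<alpha>) \<and>
    (\<forall>x\<in>\<Union>\<alpha>\<in>{1..s}. I \<alpha> \<times> J \<alpha>. rational_over r Y (zvar x :: 'k zpoly))"
  using assms
proof (induction s)
  case 0
  then show ?case by (intro exI[of _ "{}"]) auto
next
  case (Suc s)
  let ?X = "\<Union>\<alpha>\<in>{1..s}. I \<alpha> \<times> J \<alpha>"
  have "\<exists>Y. Y \<subseteq> ?X \<and> card Y + (\<Sum>\<alpha>=1..s. (card (I \<alpha>) - r) * (card (J \<alpha>) - r)) \<le> card ?X \<and>
    (\<forall>x\<in>?X. rational_over r Y (zvar x :: 'k zpoly))"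
    by (rule Suc.IH) (use Suc.prems in auto)
  then obtain Y where Y: "Y \<subseteq> ?X" "card Y + (\<Sum>\<alpha>=1..s. (card (I \<alpha>) - r) * (card (J \<alpha>) - r)) \<le> card ?X"
    "\<And>x. x \<in> ?X \<Longrightarrow> rational_over r Y (zvar x :: 'k zpoly)" by blast
  have block: "finite (I (Suc s))" "finite (J (Suc s))" "r \<le> card (I (Suc s))" "r \<le> card (J (Suc s))"
    using Suc.prems(1)[of "Suc s"] by auto
  obtain I' J' where I': "finite I'" "finite J'"
      "(I (Suc s) \<times> J (Suc s)) \<inter> ?X \<subseteq> I' \<times> J'" "min (card I') (card J') \<le> r"
    using Suc.prems(2)[of "Suc s"] by (auto simp: atLeastLessThanSuc_atLeastAtMost)
  have finX: "finite ?X" using Suc.prems(1) by auto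
  have X: "(\<Union>\<alpha>\<in>{1..Suc s}. I \<alpha> \<times> J \<alpha>) = ?X \<union> I (Suc s) \<times> J (Suc s)"
    by (auto simp: atLeastAtMostSuc_conv)
  obtain Y' where "Y' \<subseteq> ?X \<union> I (Suc s) \<times> J (Suc s)"
    "card Y' + ((\<Sum>\<alpha>=1..s. (card (I \<alpha>) - r) * (card (J \<alpha>) - r)) +
        (card (I (Suc s)) - r) * (card (J (Suc s)) - r)) \<le> card (?X \<union> I (Suc s) \<times> J (Suc s))"
    "\<And>x. x \<in> ?X \<union> I (Suc s) \<times> J (Suc s) \<Longrightarrow> rational_over r Y' (zvar x :: 'k zpoly)"
    using spanning_set_add_block[OF finX block(1,2) I'(1,2) Y block(3,4) I'(3,4)] by blast
  then show ?case unfolding X by (intro exI[of _ Y']) auto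
qed

end

section \<open>Algebraic relations by counting monomials\<close>

text \<open>
Gaussian elimination, with unknowns indexed by \<open>A\<close> and equations by \<open>B\<close>: the equation \<open>b\<close> eliminates
an unknown \<open>a0\<close> that occurs in it, which leaves one unknown and one equation less.
\<close>

lemma homogeneous_system_has_solution:
  fixes M :: "'a \<Rightarrow> 'b \<Rightarrow> 'k::field"
  assumes "finite B" "finite A" "card B < card A"
  shows "\<exists>c. (\<exists>a\<in>A. c a \<noteq> 0) \<and> (\<forall>b\<in>B. (\<Sum>a\<in>A. c a * M a b) = 0)"
  using assms
proof (induction B arbitrary: A M rule: finite_induct)
  case empty
  then have "A \<noteq> {}" by auto
  then show ?case by (intro exI[of _ "\<lambda>_. 1"]) auto
next
  case (insert b B)
  show ?case
  proof (cases "\<forall>a\<in>A. M a b = 0")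
    case True
    have "card B < card A" using insert.prems insert.hyps by simp
    then obtain c where "\<exists>a\<in>A. c a \<noteq> 0" "\<forall>b\<in>B. (\<Sum>a\<in>A. c a * M a b) = 0"
      using insert.IH[OF insert.prems(1), of M] by blast
    then show ?thesis using True by (intro exI[of _ c]) auto
  next
    case False
    then obtain a0 where a0: "a0 \<in> A" "M a0 b \<noteq> 0" by blast
    let ?A = "A - {a0}" and ?M = "\<lambda>a \<beta>. M a \<beta> - M a b / M a0 b * M a0 \<beta>"
    have "finite ?A" "card B < card ?A" using insert.prems insert.hyps a0 by simp_all
    from insert.IH[OF this, of ?M]
    obtain c where c: "\<exists>a\<in>?A. c a \<noteq> 0" "\<forall>\<beta>\<in>B. (\<Sum>a\<in>?A. c a * ?M a \<beta>) = 0"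
      by blast
    let ?c = "c(a0 := - (\<Sum>a\<in>?A. c a * M a b) / M a0 b)"
    have sum: "(\<Sum>a\<in>A. ?c a * M a \<beta>) = (\<Sum>a\<in>?A. c a * ?M a \<beta>)" for \<beta>
    proof -
      have "(\<Sum>a\<in>A. ?c a * M a \<beta>) = ?c a0 * M a0 \<beta> + (\<Sum>a\<in>?A. ?c a * M a \<beta>)"
        by (rule sum.remove) (use insert.prems a0 in auto)
      also have "(\<Sum>a\<in>?A. ?c a * M a \<beta>) = (\<Sum>a\<in>?A. c a * M a \<beta>)"
        by (intro sum.cong) auto
      also have "?c a0 * M a0 \<beta> = - (\<Sum>a\<in>?A. c a * (M a b / M a0 b * M a0 \<beta>))"
        by (simp add: sum_distrib_right sum_divide_distrib sum_negf mult.assoc)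
      finally show ?thesis by (simp add: right_diff_distrib sum_subtractf)
    qed
    have "\<forall>\<beta>\<in>insert b B. (\<Sum>a\<in>A. ?c a * M a \<beta>) = 0"
    proof
      fix \<beta> assume "\<beta> \<in> insert b B"
      then show "(\<Sum>a\<in>A. ?c a * M a \<beta>) = 0"
        unfolding sum using c(2) a0 by (cases "\<beta> = b") simp_all
    qed
    moreover have "\<exists>a\<in>A. ?c a \<noteq> 0" using c(1) by auto
    ultimately show ?thesis by blast
  qed
qed

text \<open>
The degree is bounded in each variable separately: the number of such monomials is then a power,
which is easier to compare than the binomial coefficients for the total degree.
\<close>

definition exponent_box :: "'v set \<Rightarrow> nat \<Rightarrow> ('v \<Rightarrow>\<^sub>0 nat) set"
  where "exponent_box V d = {t. Poly_Mapping.keys t \<subseteq> V \<and> (\<forall>v. Poly_Mapping.lookup t v \<le> d)}"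

lemma exponent_box_bij:
  assumes "finite V"
  shows "bij_betw (\<lambda>t. restrict (Poly_Mapping.lookup t) V) (exponent_box V d) (V \<rightarrow>\<^sub>E {..d})"
proof (rule bij_betw_imageI)
  show "inj_on (\<lambda>t. restrict (Poly_Mapping.lookup t) V) (exponent_box V d)"
  proof (rule inj_onI)
    fix s t assume st: "s \<in> exponent_box V d" "t \<in> exponent_box V d"
      and eq: "restrict (Poly_Mapping.lookup s) V = restrict (Poly_Mapping.lookup t) V"
    show "s = t"
    proof (rule poly_mapping_eqI)
      fix v show "Poly_Mapping.lookup s v = Poly_Mapping.lookup t v"
      proof (cases "v \<in> V")
        case True
        then show ?thesis using fun_cong[OF eq, of v] by simp
      next
        case False
        then have "v \<notin> Poly_Mapping.keys s" "v \<notin> Poly_Mapping.keys t"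
          using st by (auto simp: exponent_box_def)
        then show ?thesis by (simp add: in_keys_iff)
      qed
    qed
  qed
  show "(\<lambda>t. restrict (Poly_Mapping.lookup t) V) ` exponent_box V d = V \<rightarrow>\<^sub>E {..d}"
  proof (intro equalityI subsetI)
    fix g assume g: "g \<in> V \<rightarrow>\<^sub>E {..d}"
    let ?t = "Abs_poly_mapping (\<lambda>v. if v \<in> V then g v else 0)"
    have "finite {v. (if v \<in> V then g v else 0) \<noteq> 0}"
      by (rule finite_subset[OF _ assms]) auto
    then have l: "Poly_Mapping.lookup ?t v = (if v \<in> V then g v else 0)" for v
      by (simp add: Abs_poly_mapping_inverse)
    then have "?t \<in> exponent_box V d"
      using g by (auto simp: exponent_box_def in_keys_iff split: if_splits)
    moreover have "restrict (Poly_Mapping.lookup ?t) V = g"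
      using g by (auto simp: l restrict_def fun_eq_iff PiE_def extensional_def)
    ultimately show "g \<in> (\<lambda>t. restrict (Poly_Mapping.lookup t) V) ` exponent_box V d"
      by (intro image_eqI) simp_all
  qed (auto simp: exponent_box_def)
qed

lemma finite_exponent_box: "finite V \<Longrightarrow> finite (exponent_box V d)"
  by (simp add: bij_betw_finite[OF exponent_box_bij] finite_PiE)

lemma card_exponent_box: "finite V \<Longrightarrow> card (exponent_box V d) = Suc d ^ card V"
  by (simp add: bij_betw_same_card[OF exponent_box_bij] card_PiE)

definition box_poly :: "(nat \<times> nat) set \<Rightarrow> nat \<Rightarrow> 'k::field zpoly \<Rightarrow> bool"
  where "box_poly V d p \<longleftrightarrow> Poly_Mapping.keys p \<subseteq> exponent_box V d"

lemma box_poly_mono: "box_poly V d p \<Longrightarrow> d \<le> e \<Longrightarrow> box_poly V e p"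
  unfolding box_poly_def exponent_box_def by (blast intro: order_trans)

lemma box_poly_exists:
  assumes "p \<in> polys_in V"
  shows "\<exists>d. box_poly V d p"
proof -
  let ?d = "\<Sum>t\<in>Poly_Mapping.keys p. \<Sum>v\<in>Poly_Mapping.keys t. Poly_Mapping.lookup t v"
  have "Poly_Mapping.lookup t v \<le> ?d" if t: "t \<in> Poly_Mapping.keys p" for t v
  proof (cases "v \<in> Poly_Mapping.keys t")
    case True
    then have "Poly_Mapping.lookup t v \<le> (\<Sum>v\<in>Poly_Mapping.keys t. Poly_Mapping.lookup t v)"
      by (intro member_le_sum) auto
    also have "\<dots> \<le> ?d" using t by (intro member_le_sum) auto
    finally show ?thesis .
  qed (simp add: in_keys_iff)
  then show ?thesis
    using assms unfolding box_poly_def exponent_box_def polys_in_def by blast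
qed

lemma box_poly_1: "box_poly V 0 1"
  by (simp add: box_poly_def exponent_box_def)

lemma box_poly_mult:
  assumes "box_poly V d p" "box_poly V e q"
  shows "box_poly V (d + e) (p * q)"
  unfolding box_poly_def
proof
  fix t assume "t \<in> Poly_Mapping.keys (p * q)"
  then obtain a b where "a \<in> Poly_Mapping.keys p" "b \<in> Poly_Mapping.keys q" "t = a + b"
    using keys_mult[of p q] by blast
  moreover from this have "a \<in> exponent_box V d" "b \<in> exponent_box V e"
    using assms by (auto simp: box_poly_def)
  ultimately show "t \<in> exponent_box V (d + e)"
    using Poly_Mapping.keys_add[of a b]
    by (auto simp: exponent_box_def lookup_add intro!: add_mono)
qed

lemma box_poly_power: "box_poly V d p \<Longrightarrow> box_poly V (k * d) (p ^ k)"
  by (induction k) (auto simp: box_poly_1 intro: box_poly_mult)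

lemma box_poly_prod:
  "(\<And>i. i \<in> A \<Longrightarrow> box_poly V d (f i)) \<Longrightarrow> box_poly V (card A * d) (\<Prod>i\<in>A. f i)"
  by (induction A rule: infinite_finite_induct) (auto simp: box_poly_1 intro: box_poly_mult)

context
  assumes inf: "infinite (UNIV :: 'k::field set)"
begin

lemma not_vanishes_on_rank_prod:
  assumes "\<And>i. i \<in> A \<Longrightarrow> \<not> vanishes_on_rank r (f i :: 'k zpoly)"
  shows "\<not> vanishes_on_rank r (\<Prod>i\<in>A. f i)"
  using assms
proof (induction A rule: infinite_finite_induct)
  case (insert x F)
  then show ?case using vanishes_on_rank_mult[OF inf, of r "f x" "\<Prod>i\<in>F. f i"] by auto
qed (auto simp: not_vanishes_on_rank_1)

lemma common_denominator:
  assumes "finite S" and "\<And>x. x \<in> S \<Longrightarrow> rational_over r Y (zvar x :: 'k zpoly)"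
  obtains D P where "D \<in> polys_in Y" "\<not> vanishes_on_rank r (D :: 'k zpoly)"
    "\<And>x. x \<in> S \<Longrightarrow> P x \<in> polys_in Y" "\<And>x. x \<in> S \<Longrightarrow> vanishes_on_rank r (D * zvar x - P x)"
proof -
  have "\<forall>x\<in>S. \<exists>D P. D \<in> polys_in Y \<and> P \<in> polys_in Y \<and> \<not> vanishes_on_rank r D \<and>
      vanishes_on_rank r (D * zvar x - P :: 'k zpoly)"
    using assms(2) unfolding rational_over_def by blast
  then obtain D P where D: "\<And>x. x \<in> S \<Longrightarrow> D x \<in> polys_in Y" "\<And>x. x \<in> S \<Longrightarrow> P x \<in> polys_in Y"
      "\<And>x. x \<in> S \<Longrightarrow> \<not> vanishes_on_rank r (D x)"
    and eq: "\<And>x. x \<in> S \<Longrightarrow> vanishes_on_rank r (D x * zvar x - P x :: 'k zpoly)"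
    by metis
  show thesis
  proof (rule that[of "\<Prod>x\<in>S. D x" "\<lambda>x. (\<Prod>y\<in>S - {x}. D y) * P x"])
    fix x assume x: "x \<in> S"
    show "(\<Prod>y\<in>S - {x}. D y) * P x \<in> polys_in Y"
      using D x by (intro polys_in_mult polys_in_prod) auto
    have "(\<Prod>x\<in>S. D x) * zvar x - (\<Prod>y\<in>S - {x}. D y) * P x =
        (\<Prod>y\<in>S - {x}. D y) * (D x * zvar x - P x)"
      by (simp add: prod.remove[OF assms(1) x] algebra_simps)
    then show "vanishes_on_rank r ((\<Prod>x\<in>S. D x) * zvar x - (\<Prod>y\<in>S - {x}. D y) * P x)"
      using vanishes_on_rank_mult_left[OF eq[OF x]] by simp
  qed (use D in \<open>auto intro!: polys_in_prod not_vanishes_on_rank_prod\<close>)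
qed

text \<open>
If the entries in \<open>S\<close> are rational over \<open>Y\<close> with common denominator \<open>D\<close>, then \<open>D ^ (E |S|)\<close> times a
monomial in \<open>S\<close> with exponents at most \<open>E\<close> agrees on the variety with a polynomial in \<open>Y\<close> whose
exponents are bounded linearly in \<open>E\<close>. There are \<open>(E + 1) ^ |S|\<close> such monomials, but the polynomials
live in a space of dimension \<open>O(E ^ |Y|)\<close>. For large \<open>E\<close> there is a linear relation, and the power of
\<open>D\<close> cancels by primality.
\<close>

lemma algebraic_relation_exists:
  assumes fin: "finite S" "finite Y" and card: "card Y < card S"
    and rat: "\<And>x. x \<in> S \<Longrightarrow> rational_over r Y (zvar x :: 'k zpoly)"
  obtains f :: "'k zpoly" where "f \<noteq> 0" "f \<in> polys_in S" "vanishes_on_rank r f"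
proof -
  obtain D P where D: "D \<in> polys_in Y" "\<not> vanishes_on_rank r (D :: 'k zpoly)"
    and P: "\<And>x. x \<in> S \<Longrightarrow> P x \<in> polys_in Y" "\<And>x. x \<in> S \<Longrightarrow> vanishes_on_rank r (D * zvar x - P x)"
    using common_denominator[OF fin(1) rat] by blast
  obtain c where c: "box_poly Y c D" "\<And>x. x \<in> S \<Longrightarrow> box_poly Y c (P x)"
  proof -
    obtain d where d: "box_poly Y d D" using box_poly_exists[OF D(1)] by blast
    obtain e where e: "\<And>x. x \<in> S \<Longrightarrow> box_poly Y (e x) (P x)" using box_poly_exists[OF P(1)] by metis
    show thesis
    proof (rule that[of "d + (\<Sum>x\<in>S. e x)"])
      show "box_poly Y (d + (\<Sum>x\<in>S. e x)) D" by (rule box_poly_mono[OF d]) simp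
      show "box_poly Y (d + (\<Sum>x\<in>S. e x)) (P x)" if "x \<in> S" for x
        using fin(1) that by (intro box_poly_mono[OF e[OF that]] trans_le_add2 member_le_sum) auto
    qed
  qed
  let ?M = "card S" and ?N = "card Y"
  \<comment> \<open>large enough to win the comparison of cardinalities below\<close>
  define E where "E = (?M * c + 1) ^ ?N"
  define d where "d = ?M * (E * c)"
  \<comment> \<open>equal on the variety to the monomial \<open>a\<close> times one factor \<open>D ^ E\<close> for each element of \<open>S\<close>\<close>
  define Q where "Q a = (\<Prod>x\<in>S. D ^ (E - Poly_Mapping.lookup a x) * P x ^ Poly_Mapping.lookup a x)" for a
  have Q: "box_poly Y d (Q a)" if a: "a \<in> exponent_box S E" for a
    unfolding Q_def d_def
  proof (rule box_poly_prod)
    fix x assume "x \<in> S"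
    moreover have "Poly_Mapping.lookup a x \<le> E" using a unfolding exponent_box_def by blast
    ultimately show "box_poly Y (E * c) (D ^ (E - Poly_Mapping.lookup a x) * P x ^ Poly_Mapping.lookup a x)"
      using box_poly_mult[OF box_poly_power[OF c(1)] box_poly_power[OF c(2)],
          of x "E - Poly_Mapping.lookup a x" "Poly_Mapping.lookup a x"]
      by (simp flip: add_mult_distrib)
  qed
  have "card (exponent_box Y d) < card (exponent_box S E)"
  proof -
    have "card (exponent_box Y d) = (?M * (E * c) + 1) ^ ?N"
      by (simp add: card_exponent_box[OF fin(2)] d_def)
    also have "\<dots> \<le> ((?M * c + 1) * (E + 1)) ^ ?N"
      by (intro power_mono) (auto simp: algebra_simps)
    also have "\<dots> = E * (E + 1) ^ ?N" unfolding power_mult_distrib E_def ..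
    also have "\<dots> < (E + 1) * (E + 1) ^ ?N" by simp
    also have "\<dots> = (E + 1) ^ (?N + 1)" by simp
    also have "\<dots> \<le> (E + 1) ^ ?M" using card by (intro power_increasing) auto
    also have "\<dots> = card (exponent_box S E)" by (simp add: card_exponent_box[OF fin(1)])
    finally show ?thesis .
  qed
  then obtain u where u: "\<exists>a\<in>exponent_box S E. u a \<noteq> 0"
    and sys: "\<forall>b\<in>exponent_box Y d. (\<Sum>a\<in>exponent_box S E. u a * Poly_Mapping.lookup (Q a) b) = 0"
    using homogeneous_system_has_solution[OF finite_exponent_box[OF fin(2)] finite_exponent_box[OF fin(1)],
        of d E "\<lambda>a. Poly_Mapping.lookup (Q a)"] by blast
  define f where "f = (\<Sum>a\<in>exponent_box S E. Poly_Mapping.single a (u a) :: 'k zpoly)"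
  have lookup_f: "Poly_Mapping.lookup f a = u a" if "a \<in> exponent_box S E" for a
    using that finite_exponent_box[OF fin(1)]
    by (simp add: f_def lookup_sum lookup_single when_def)
  have "f \<noteq> 0" using u lookup_f by fastforce
  moreover have "f \<in> polys_in S"
    unfolding f_def by (rule polys_in_sum) (auto simp: polys_in_def exponent_box_def)
  moreover have "vanishes_on_rank r f"
  proof -
    have "vanishes_on_rank r ((\<Prod>x\<in>S. D ^ E) * f)"
      unfolding vanishes_on_rank_def
    proof (intro allI)
      fix U V :: "nat \<Rightarrow> nat \<Rightarrow> 'k"
      let ?w = "matprod r U V"
      have Px: "mpoly_value ?w (P x) = mpoly_value ?w D * ?w x" if "x \<in> S" for x
        using P(2)[OF that] by (simp add: vanishes_on_rank_diff_iff mpoly_value_mult)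
      have "mpoly_value ?w (\<Prod>x\<in>S. D ^ E) * monom_value ?w a = mpoly_value ?w (Q a)"
        if a: "a \<in> exponent_box S E" for a
      proof -
        have "monom_value ?w a = (\<Prod>x\<in>S. ?w x ^ Poly_Mapping.lookup a x)"
          using a fin by (intro monom_value_superset) (auto simp: exponent_box_def)
        moreover have "mpoly_value ?w D ^ E * ?w x ^ Poly_Mapping.lookup a x =
            mpoly_value ?w (D ^ (E - Poly_Mapping.lookup a x) * P x ^ Poly_Mapping.lookup a x)"
          if x: "x \<in> S" for x
        proof -
          have "Poly_Mapping.lookup a x \<le> E" using a unfolding exponent_box_def by blast
          then have "mpoly_value ?w D ^ E = mpoly_value ?w D ^ (E - Poly_Mapping.lookup a x) *
              mpoly_value ?w D ^ Poly_Mapping.lookup a x"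
            by (simp flip: power_add)
          then show ?thesis
            by (simp add: mpoly_value_mult mpoly_value.hom_power Px[OF x] power_mult_distrib mult.assoc)
        qed
        ultimately show ?thesis
          unfolding Q_def mpoly_value.hom_prod mpoly_value.hom_power[of ?w D]
          by (simp only: prod.distrib[symmetric] cong: prod.cong)
      qed
      then have "mpoly_value ?w ((\<Prod>x\<in>S. D ^ E) * f) = (\<Sum>a\<in>exponent_box S E. u a * mpoly_value ?w (Q a))"
        by (simp add: mpoly_value_mult f_def mpoly_value_sum sum_distrib_left mult.left_commute)
      also have "\<dots> = (\<Sum>a\<in>exponent_box S E. \<Sum>b\<in>exponent_box Y d.
          u a * Poly_Mapping.lookup (Q a) b * monom_value ?w b)"
      proof (rule sum.cong[OF refl])
        fix a assume "a \<in> exponent_box S E"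
        then have "Poly_Mapping.keys (Q a) \<subseteq> exponent_box Y d"
          using Q by (simp add: box_poly_def)
        then show "u a * mpoly_value ?w (Q a) = (\<Sum>b\<in>exponent_box Y d.
            u a * Poly_Mapping.lookup (Q a) b * monom_value ?w b)"
          by (simp add: mpoly_value_superset[OF finite_exponent_box[OF fin(2)]]
            sum_distrib_left mult.assoc)
      qed
      also have "\<dots> = (\<Sum>b\<in>exponent_box Y d. (\<Sum>a\<in>exponent_box S E. u a * Poly_Mapping.lookup (Q a) b) *
          monom_value ?w b)"
        unfolding sum_distrib_right by (rule sum.swap)
      also have "\<dots> = 0" using sys by simp
      finally show "mpoly_value ?w ((\<Prod>x\<in>S. D ^ E) * f) = 0" .
    qed
    moreover have "\<not> vanishes_on_rank r (D ^ E)"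
      using not_vanishes_on_rank_prod[of "{..<E}" r "\<lambda>_. D"] D(2) by simp
    then have "\<not> vanishes_on_rank r (\<Prod>x\<in>S. D ^ E)"
      by (intro not_vanishes_on_rank_prod)
    ultimately show ?thesis using vanishes_on_rank_mult[OF inf] by blast
  qed
  ultimately show thesis by (rule that)
qed

end

section \<open>Dependent sets of the determinantal matroid\<close>

theorem theorem5p9:
  fixes r m n s :: nat
    and \<Omega> :: "(nat \<times> nat) set"
    and I J :: "nat \<Rightarrow> nat set"
  assumes "infinite (UNIV :: 'k::field set)"
    and "0 < r" and "0 < m" and "0 < n" and "r < min m n"
    and "\<Omega> \<subseteq> {1..m} \<times> {1..n}"
    and "\<And>\<alpha>. \<alpha> \<in> {1..s} \<Longrightarrow>
          I \<alpha> \<times> J \<alpha> \<subseteq> {1..m} \<times> {1..n} \<and> r < card (I \<alpha>) \<and> r < card (J \<alpha>)"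
    and "\<And>\<alpha>. 1 < \<alpha> \<Longrightarrow> \<alpha> \<le> s \<Longrightarrow>
          \<exists>I' J'. I' \<subseteq> {1..m} \<and> J' \<subseteq> {1..n} \<and>
            (I \<alpha> \<times> J \<alpha>) \<inter> (\<Union>k\<in>{1..<\<alpha>}. I k \<times> J k) \<subseteq> I' \<times> J' \<and>
            min (card I') (card J') \<le> r"
    and "card ((\<Union>\<alpha>\<in>{1..s}. I \<alpha> \<times> J \<alpha>) - \<Omega>)
          < (\<Sum>\<alpha>=1..s. (card (I \<alpha>) - r) * (card (J \<alpha>) - r))"
  shows "dependent_in (determinantal_matroid TYPE('k) r m n) \<Omega>"
proof -
  note inf = assms(1)
  let ?X = "\<Union>\<alpha>\<in>{1..s}. I \<alpha> \<times> J \<alpha>"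
  let ?d = "\<Sum>\<alpha>=1..s. (card (I \<alpha>) - r) * (card (J \<alpha>) - r)"
  have fin: "finite (I \<alpha>) \<and> finite (J \<alpha>) \<and> r \<le> card (I \<alpha>) \<and> r \<le> card (J \<alpha>)" if "\<alpha> \<in> {1..s}" for \<alpha>
    using assms(7)[OF that] by (metis card.infinite less_imp_le not_less0)
  \<comment> \<open>for the first block there is no overlap, and the empty rectangle contains it\<close>
  have overlap: "\<exists>I' J'. finite I' \<and> finite J' \<and>
      (I \<alpha> \<times> J \<alpha>) \<inter> (\<Union>k\<in>{1..<\<alpha>}. I k \<times> J k) \<subseteq> I' \<times> J' \<and> min (card I') (card J') \<le> r"
    if "\<alpha> \<in> {1..s}" for \<alpha>
  proof (cases "\<alpha> = 1")
    case True
    then show ?thesis by (intro exI[of _ "{}"]) auto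
  next
    case False
    then have "1 < \<alpha>" "\<alpha> \<le> s" using that by auto
    from assms(8)[OF this] show ?thesis by (meson finite_atLeastAtMost finite_subset)
  qed
  have "\<exists>Y. Y \<subseteq> ?X \<and> card Y + ?d \<le> card ?X \<and>
      (\<forall>x\<in>?X. rational_over r Y (zvar x :: 'k zpoly))"
    by (rule spanning_set_of_blocks[OF inf]) (fact fin, fact overlap)
  then obtain Y where Y: "Y \<subseteq> ?X" "card Y + ?d \<le> card ?X"
      "\<And>x. x \<in> ?X \<Longrightarrow> rational_over r Y (zvar x :: 'k zpoly)"
    by blast
  have finX: "finite ?X" using fin by auto
  have "card ?X = card (?X \<inter> \<Omega>) + card (?X - \<Omega>)"
    using card_Int_Diff finX by blast
  then have card: "card Y < card (?X \<inter> \<Omega>)" using Y(2) assms(9) by linarith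
  have finite: "finite (?X \<inter> \<Omega>)" "finite Y"
    using finite_subset[OF Y(1) finX] finX by simp_all
  have "rational_over r Y (zvar x :: 'k zpoly)" if "x \<in> ?X \<inter> \<Omega>" for x
    using Y(3) IntD1[OF that] .
  from algebraic_relation_exists[OF inf finite card this]
  obtain f :: "'k zpoly" where f: "f \<noteq> 0" "f \<in> polys_in (?X \<inter> \<Omega>)" "vanishes_on_rank r f" .
  have \<Omega>: "\<Omega> \<subseteq> grid m n" using assms(6) by (simp add: grid_def)
  have f\<Omega>: "f \<in> polys_in \<Omega>" using subsetD[OF polys_in_mono[OF Int_lower2] f(2)] .
  have "f \<in> polys_in (grid m n)" using subsetD[OF polys_in_mono[OF \<Omega>] f\<Omega>] .
  from vanishes_on_rank_imp_power_in_determinantal_ideal[OF inf f(3) this]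
  obtain N where N: "f ^ N \<in> determinantal_ideal (r + 1) m n" ..
  have "f ^ N \<noteq> 0"
  proof -
    obtain w where "mpoly_value w f \<noteq> 0" using mpoly_value_eq_0_imp[OF inf, of f] f(1) by metis
    then have "mpoly_value w (f ^ N) \<noteq> 0" by (simp add: mpoly_value.hom_power)
    then show ?thesis by (metis mpoly_value_0)
  qed
  moreover have "f ^ N \<in> polys_in \<Omega>" using f\<Omega> by (rule polys_in_power)
  ultimately have "determinantal_ideal (r + 1) m n \<inter> polys_in \<Omega> \<noteq> {0 :: 'k zpoly}"
    using N by blast
  then show ?thesis
    using \<Omega> by (simp add: dependent_in_def determinantal_matroid_def)
qed

end
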